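(* Let $R=K[x_1,\ldots,x_n]$ be the (standard graded) polynomial ring over a field $K$, and let $M$ be a finitely generated graded $R$-module of projective dimension $p$. Then $$\operatorname{reg}_j(M)\leq \Big(\sum_{k=0}^j\rho_k(M)\Big)-j\quad\text{for } j=0,\ldots,p.$$ In particular, $\operatorname{reg}(M)\leq \max\big\{\big(\sum_{k=0}^j\rho_k(M)\big)-j : j=0,\ldots,p\big\}$.
   Context: Let $\mathfrak m=(x_1,\dots,x_n)$. For $0\le j\le p$, $\operatorname{reg}_j(M):=\max\{k-j : \beta^R_{jk}(M)\neq 0\}$, where $\beta^R_{jk}(M)=\dim_K\operatorname{Tor}^R_j(M,K)_k$ are the graded Betti numbers of $M$ over $R$. In particular, $\operatorname{reg}_0(M)$ is the maximal degree of an element of a minimal homogeneous system of generators of $M$. The regularity of $M$ is $\operatorname{reg}(M):=\max_{0\leq j\leq p}\operatorname{reg}_j(M)$. Artin--Rees number: for a finitely generated graded $R$-module $F$ and a graded submodule $N\subset F$, $\rho(N,F)$ denotes the smallest integer $r\ge 0$ such that $N\cap \mathfrak m^iF=\mathfrak m^{i-r}(N\cap \mathfrak m^rF)$ for all $i\geq r$. Let $(\mathbb F,\varphi)$ be a graded minimal free $R$-resolution of $M$, $\varphi_j:F_j\to F_{j-1}$. For $j\geq 1$ set $N_j=\operatorname{Im}(\varphi_j)\subset F_{j-1}$ and $\rho_j(M):=\rho(N_j,F_{j-1})$; moreover set $\rho_0(M):=\operatorname{reg}_0(M)$. *)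

theory Defs
  imports Complex_Main "HOL-Library.Poly_Mapping" "HOL-Library.Extended_Nat"
begin

section \<open>The standard graded polynomial ring\<close>

text \<open>\<open>K[x\<^sub>1,\<dots>,x\<^sub>n]\<close>, with the variables indexed by the finite type \<open>'n\<close>, so \<open>n = CARD('n)\<close>;
  the exponent vectors are the elements of \<open>'n \<Rightarrow>\<^sub>0 nat\<close>.\<close>

type_synonym ('n, 'k) mpoly = "('n \<Rightarrow>\<^sub>0 nat) \<Rightarrow>\<^sub>0 'k"

definition mdeg :: "('n::finite \<Rightarrow>\<^sub>0 nat) \<Rightarrow> nat" where
  "mdeg m = (\<Sum>i\<in>UNIV. Poly_Mapping.lookup m i)"

definition var :: "'n \<Rightarrow> ('n, 'k::field) mpoly" where
  "var i = Poly_Mapping.single (Poly_Mapping.single i 1) 1"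

definition const :: "'k::field \<Rightarrow> ('n, 'k) mpoly" where
  "const c = Poly_Mapping.single 0 c"

text \<open>The graded piece \<open>R\<^sub>e\<close>; it is \<open>{0}\<close> for \<open>e < 0\<close>.\<close>

definition poly_gr :: "int \<Rightarrow> ('n::finite, 'k::field) mpoly set" where
  "poly_gr e = {f. \<forall>m\<in>Poly_Mapping.keys f. int (mdeg m) = e}"

definition ideal_smult ::
  "('r::comm_ring_1 \<Rightarrow> 'b::ab_group_add \<Rightarrow> 'b) \<Rightarrow> 'r set \<Rightarrow> 'b set \<Rightarrow> 'b set" where
  "ideal_smult scale I N = module.span scale {scale a x | a x. a \<in> I \<and> x \<in> N}"

lemma module_mult: "module ((*) :: 'r::comm_ring_1 \<Rightarrow> 'r \<Rightarrow> 'r)"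
  by unfold_locales (simp_all add: algebra_simps)

primrec ideal_pow :: "'r::comm_ring_1 set \<Rightarrow> nat \<Rightarrow> 'r set" where
  "ideal_pow I 0 = UNIV"
| "ideal_pow I (Suc i) = ideal_smult (*) I (ideal_pow I i)"

definition max_ideal :: "('n::finite, 'k::field) mpoly set" where
  "max_ideal = module.span (*) (range var)"

section \<open>Graded modules\<close>

locale graded_module = module scale
  for scale :: "('n::finite, 'k::field) mpoly \<Rightarrow> 'm::ab_group_add \<Rightarrow> 'm" +
  fixes gr :: "int \<Rightarrow> 'm set"
  assumes gr_zero: "0 \<in> gr d"
    and gr_add: "x \<in> gr d \<Longrightarrow> y \<in> gr d \<Longrightarrow> x + y \<in> gr d"
    and gr_scale: "a \<in> poly_gr e \<Longrightarrow> x \<in> gr d \<Longrightarrow> scale a x \<in> gr (e + d)"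
    and gr_direct_sum: "\<exists>!c :: int \<Rightarrow>\<^sub>0 'm. (\<forall>d. Poly_Mapping.lookup c d \<in> gr d) \<and>
          x = (\<Sum>d\<in>Poly_Mapping.keys c. Poly_Mapping.lookup c d)"

definition finitely_generated ::
  "('r::comm_ring_1 \<Rightarrow> 'm::ab_group_add \<Rightarrow> 'm) \<Rightarrow> bool" where
  "finitely_generated scale \<longleftrightarrow> (\<exists>S. finite S \<and> module.span scale S = UNIV)"

section \<open>Free modules inside the free module of countable rank\<close>

text \<open>All free and projective modules below are realised as submodules of the free module
  \<open>nat \<Rightarrow>\<^sub>0 'r\<close> of countable rank over \<open>'r\<close>.\<close>

definition fscale :: "'r::comm_ring_1 \<Rightarrow> (nat \<Rightarrow>\<^sub>0 'r) \<Rightarrow> (nat \<Rightarrow>\<^sub>0 'r)" where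
  "fscale a = Poly_Mapping.map ((*) a)"

lemma lookup_fscale: "Poly_Mapping.lookup (fscale a f) i = a * Poly_Mapping.lookup f i"
  by (simp add: fscale_def Poly_Mapping.map.rep_eq when_def)

lemma module_fscale: "module (fscale :: 'r::comm_ring_1 \<Rightarrow> _)"
  by unfold_locales
    (rule poly_mapping_eqI, simp add: lookup_fscale lookup_add algebra_simps)+

definition kscale ::
  "'k::field \<Rightarrow> (nat \<Rightarrow>\<^sub>0 ('n, 'k) mpoly) \<Rightarrow> (nat \<Rightarrow>\<^sub>0 ('n, 'k) mpoly)" where
  "kscale c = fscale (const c)"

lemma vector_space_kscale:
  "vector_space (kscale :: 'k::field \<Rightarrow> (nat \<Rightarrow>\<^sub>0 ('n, 'k) mpoly) \<Rightarrow> _)"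
proof -
  interpret module "fscale :: ('n, 'k) mpoly \<Rightarrow> _" by (rule module_fscale)
  have "const (c + d) = (const c + const d :: ('n, 'k) mpoly)"
    "const c * const d = (const (c * d) :: ('n, 'k) mpoly)"
    "const 1 = (1 :: ('n, 'k) mpoly)" for c d :: 'k
    by (simp_all add: const_def single_add mult_single)
  then show ?thesis
    by unfold_locales (simp_all add: kscale_def algebra_simps)
qed

definition free_mod :: "nat \<Rightarrow> (nat \<Rightarrow>\<^sub>0 'r::comm_ring_1) set" where
  "free_mod b = {f. Poly_Mapping.keys f \<subseteq> {..<b}}"

text \<open>Degree \<open>k\<close> part of \<open>R(-d 0) \<oplus> \<dots> \<oplus> R(-d (b-1))\<close>: the \<open>i\<close>-th basis vector has degree \<open>d i\<close>.\<close>

definition free_gr ::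
  "nat \<Rightarrow> (nat \<Rightarrow> int) \<Rightarrow> int \<Rightarrow> (nat \<Rightarrow>\<^sub>0 ('n::finite, 'k::field) mpoly) set" where
  "free_gr b d k = {f \<in> free_mod b. \<forall>i<b. Poly_Mapping.lookup f i \<in> poly_gr (k - d i)}"

section \<open>Graded free resolutions\<close>

text \<open>The data of a complex \<open>\<dots> \<rightarrow> F\<^sub>2 \<rightarrow> F\<^sub>1 \<rightarrow> F\<^sub>0 \<rightarrow> M\<close> of finitely generated graded free modules
  over \<open>M\<close>. \<open>dif j : F\<^sub>j \<rightarrow> F\<^sub>j\<^sub>-\<^sub>1\<close> is used for \<open>j \<ge> 1\<close> only, and only its restriction to \<open>F\<^sub>j\<close>
  matters; linear maps are totalised, which is harmless as \<open>F\<^sub>j\<close> is a direct summand of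
  \<open>nat \<Rightarrow>\<^sub>0 R\<close>.\<close>

record (overloaded) ('n, 'k::zero, 'm) free_complex =
  rnk :: "nat \<Rightarrow> nat"
  shift :: "nat \<Rightarrow> nat \<Rightarrow> int"
  dif :: "nat \<Rightarrow> (nat \<Rightarrow>\<^sub>0 ('n, 'k) mpoly) \<Rightarrow> (nat \<Rightarrow>\<^sub>0 ('n, 'k) mpoly)"
  aug :: "(nat \<Rightarrow>\<^sub>0 ('n, 'k) mpoly) \<Rightarrow> 'm"

definition fmod ::
  "('n::finite, 'k::field, 'm) free_complex \<Rightarrow> nat \<Rightarrow> (nat \<Rightarrow>\<^sub>0 ('n, 'k) mpoly) set" where
  "fmod F j = free_mod (rnk F j)"

definition fgr ::
  "('n::finite, 'k::field, 'm) free_complex \<Rightarrow> nat \<Rightarrow> int \<Rightarrow> (nat \<Rightarrow>\<^sub>0 ('n, 'k) mpoly) set" where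
  "fgr F j k = free_gr (rnk F j) (shift F j) k"

definition graded_free_resolution ::
  "(('n::finite, 'k::field) mpoly \<Rightarrow> 'm::ab_group_add \<Rightarrow> 'm) \<Rightarrow> (int \<Rightarrow> 'm set)
     \<Rightarrow> ('n, 'k, 'm) free_complex \<Rightarrow> bool" where
  "graded_free_resolution scale gr F \<longleftrightarrow>
     module_hom fscale scale (aug F) \<and>
     (\<forall>k. aug F ` fgr F 0 k \<subseteq> gr k) \<and>
     aug F ` fmod F 0 = UNIV \<and>
     {x \<in> fmod F 0. aug F x = 0} = dif F 1 ` fmod F 1 \<and>
     (\<forall>j\<ge>1. module_hom fscale fscale (dif F j) \<and>
            (\<forall>k. dif F j ` fgr F j k \<subseteq> fgr F (j - 1) k) \<and>
            {x \<in> fmod F j. dif F j x = 0} = dif F (Suc j) ` fmod F (Suc j))"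

definition minimal_graded_free_resolution ::
  "(('n::finite, 'k::field) mpoly \<Rightarrow> 'm::ab_group_add \<Rightarrow> 'm) \<Rightarrow> (int \<Rightarrow> 'm set)
     \<Rightarrow> ('n, 'k, 'm) free_complex \<Rightarrow> bool" where
  "minimal_graded_free_resolution scale gr F \<longleftrightarrow>
     graded_free_resolution scale gr F \<and>
     (\<forall>j\<ge>1. dif F j ` fmod F j \<subseteq> ideal_smult fscale max_ideal (fmod F (j - 1)))"

section \<open>Tor, graded Betti numbers and regularity\<close>

text \<open>\<open>Tor\<^sub>j(M,K)\<close> is the \<open>j\<close>-th homology of \<open>F \<otimes>\<^sub>R K = F / \<mm>F\<close> (with \<open>F\<^sub>0 \<otimes>\<^sub>R K \<rightarrow> 0\<close> at the end) for a
  graded free resolution \<open>F\<close> of \<open>M\<close>. The next two sets are the preimages in \<open>(F\<^sub>j)\<^sub>k\<close> of the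
  cycles and of the boundaries of degree \<open>k\<close>; since \<open>\<mm>F\<^sub>j\<close> and the image of the differential are
  homogeneous, their quotient is \<open>Tor\<^sub>j(M,K)\<^sub>k\<close>.\<close>

definition tor_cycles ::
  "('n::finite, 'k::field, 'm) free_complex \<Rightarrow> nat \<Rightarrow> int \<Rightarrow> (nat \<Rightarrow>\<^sub>0 ('n, 'k) mpoly) set" where
  "tor_cycles F j k =
     {z \<in> fgr F j k. j = 0 \<or> dif F j z \<in> ideal_smult fscale max_ideal (fmod F (j - 1))}"

definition tor_boundaries ::
  "('n::finite, 'k::field, 'm) free_complex \<Rightarrow> nat \<Rightarrow> int \<Rightarrow> (nat \<Rightarrow>\<^sub>0 ('n, 'k) mpoly) set" where
  "tor_boundaries F j k =
     {z \<in> fgr F j k. \<exists>y \<in> fmod F (Suc j).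
        z - dif F (Suc j) y \<in> ideal_smult fscale max_ideal (fmod F j)}"

text \<open>As usual, Tor is computed from some chosen (arbitrary, not necessarily minimal) graded free
  resolution. The dimension of the quotient is a difference of dimensions because \<open>(F\<^sub>j)\<^sub>k\<close> is
  finite-dimensional over \<open>K\<close>.\<close>

definition chosen_resolution ::
  "(('n::finite, 'k::field) mpoly \<Rightarrow> 'm::ab_group_add \<Rightarrow> 'm) \<Rightarrow> (int \<Rightarrow> 'm set)
     \<Rightarrow> ('n, 'k, 'm) free_complex" where
  "chosen_resolution scale gr = (SOME F. graded_free_resolution scale gr F)"

definition betti ::
  "(('n::finite, 'k::field) mpoly \<Rightarrow> 'm::ab_group_add \<Rightarrow> 'm) \<Rightarrow> (int \<Rightarrow> 'm set)
     \<Rightarrow> nat \<Rightarrow> int \<Rightarrow> nat" where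
  "betti scale gr j k =
     vector_space.dim kscale (tor_cycles (chosen_resolution scale gr) j k)
     - vector_space.dim kscale (tor_boundaries (chosen_resolution scale gr) j k)"

definition reg_at ::
  "(('n::finite, 'k::field) mpoly \<Rightarrow> 'm::ab_group_add \<Rightarrow> 'm) \<Rightarrow> (int \<Rightarrow> 'm set)
     \<Rightarrow> nat \<Rightarrow> int" where
  "reg_at scale gr j = Max {k - int j | k. betti scale gr j k \<noteq> 0}"

text \<open>Projective modules are direct summands of free modules; a countably generated one is
  isomorphic to a direct summand of \<open>nat \<Rightarrow>\<^sub>0 'r\<close>. For finitely generated modules over a Noetherian
  ring, countably generated projectives suffice to compute the projective dimension.\<close>

definition projective_submodule :: "(nat \<Rightarrow>\<^sub>0 'r::comm_ring_1) set \<Rightarrow> bool" where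
  "projective_submodule P \<longleftrightarrow> module.subspace fscale P \<and>
     (\<exists>Q. module.subspace fscale Q \<and> P \<inter> Q = {0} \<and> {x + y | x y. x \<in> P \<and> y \<in> Q} = UNIV)"

definition has_projective_resolution ::
  "('r::comm_ring_1 \<Rightarrow> 'm::ab_group_add \<Rightarrow> 'm) \<Rightarrow> nat \<Rightarrow> bool" where
  "has_projective_resolution scale l \<longleftrightarrow>
     (\<exists>(P :: nat \<Rightarrow> (nat \<Rightarrow>\<^sub>0 'r) set) \<delta> \<epsilon>.
        (\<forall>j. projective_submodule (P j)) \<and> (\<forall>j>l. P j = {0}) \<and>
        module_hom fscale scale \<epsilon> \<and> \<epsilon> ` P 0 = UNIV \<and>
        {x \<in> P 0. \<epsilon> x = 0} = \<delta> 1 ` P 1 \<and>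
        (\<forall>j\<ge>1. module_hom fscale fscale (\<delta> j) \<and> \<delta> j ` P j \<subseteq> P (j - 1) \<and>
               {x \<in> P j. \<delta> j x = 0} = \<delta> (Suc j) ` P (Suc j)))"

definition proj_dim ::
  "('r::comm_ring_1 \<Rightarrow> 'm::ab_group_add \<Rightarrow> 'm) \<Rightarrow> enat" where
  "proj_dim scale = Inf {enat l | l. has_projective_resolution scale l}"

definition reg ::
  "(('n::finite, 'k::field) mpoly \<Rightarrow> 'm::ab_group_add \<Rightarrow> 'm) \<Rightarrow> (int \<Rightarrow> 'm set) \<Rightarrow> int" where
  "reg scale gr = Max {reg_at scale gr j | j. enat j \<le> proj_dim scale}"

section \<open>Artin--Rees numbers\<close>

definition artin_rees ::
  "(nat \<Rightarrow>\<^sub>0 ('n::finite, 'k::field) mpoly) set \<Rightarrow> (nat \<Rightarrow>\<^sub>0 ('n, 'k) mpoly) set \<Rightarrow> nat" where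
  "artin_rees N F = (LEAST r. \<forall>i\<ge>r.
     N \<inter> ideal_smult fscale (ideal_pow max_ideal i) F =
     ideal_smult fscale (ideal_pow max_ideal (i - r))
       (N \<inter> ideal_smult fscale (ideal_pow max_ideal r) F))"

definition rho ::
  "(('n::finite, 'k::field) mpoly \<Rightarrow> 'm::ab_group_add \<Rightarrow> 'm) \<Rightarrow> (int \<Rightarrow> 'm set)
     \<Rightarrow> ('n, 'k, 'm) free_complex \<Rightarrow> nat \<Rightarrow> int" where
  "rho scale gr F j =
     (if j = 0 then reg_at scale gr 0
      else int (artin_rees (dif F j ` fmod F j) (fmod F (j - 1))))"

end

theory Submission
  imports Defs "HOL-Library.FuncSet"
begin

text \<open>Let \<open>F\<close> be the minimal resolution, \<open>N = Im (F\<^sub>j \<rightarrow> F\<^sub>j\<^sub>-\<^sub>1)\<close> and \<open>r = \<rho>(N, F\<^sub>j\<^sub>-\<^sub>1)\<close>. The image \<open>z\<close> of a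
  basis vector of \<open>F\<^sub>j\<close> is a minimal generator of \<open>N\<close>, so it lies outside \<open>\<mm>N\<close> and hence outside
  \<open>\<mm>\<^bsup>r+1\<^esup>F\<^sub>j\<^sub>-\<^sub>1\<close>. Therefore some coordinate of \<open>z\<close> has degree at most \<open>r\<close>, and the degree of \<open>z\<close> is at most
  \<open>r\<close> plus the largest shift of \<open>F\<^sub>j\<^sub>-\<^sub>1\<close>; induction on \<open>j\<close> gives the bound. For this the shifts of \<open>F\<close>
  must be read off Tor, which is computed from another resolution (comparison up to homotopy), and
  the Artin--Rees number must exist: graded submodules are divided by finitely many elements whose
  lowest-degree terms generate, finiteness being Dickson's lemma.\<close>

text \<open>The exponent r+1 is the first at which the Artin--Rees equality contains a factor \<mm>:
  N \<inter> \<mm>^(r+1) F = \<mm>(N \<inter> \<mm>^r F), which lies in \<mm>N. The bound is really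
  one on shifts: the largest shift grows by at most \<open>rho\<close> from one step to the next and
  starts at \<open>rho\<close> of index 0; the summand \<open>- int j\<close> only translates shifts
  into regularity. Much of the work goes into showing that totalised notions mean what they should:
  \<open>artin_rees\<close> is a LEAST, \<open>reg_at\<close> a Max, the resolution behind Tor a
  SOME, and \<open>betti\<close> a truncated difference of dimensions. Each is informative only
  after an existence, nonemptiness or finiteness statement. Two degrees have to be kept apart. The
  \<mm>-adic order of an element sees the degrees of its coefficients, whereas the grading adds the
  shifts. Division has to cancel terms of lowest coefficient degree in order to respect the
  \<mm>-adic filtration; such an order need not be well-founded, and the grading is what restores
  termination.\<close>

interpretation pm: module "(*) :: 'r::comm_ring_1 \<Rightarrow> 'r \<Rightarrow> 'r"
  by (rule module_mult)

interpretation fs: module "fscale :: 'r::comm_ring_1 \<Rightarrow> _"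
  by (rule module_fscale)

section \<open>Powers of the maximal ideal\<close>

abbreviation lookup where "lookup \<equiv> Poly_Mapping.lookup"
abbreviation keys where "keys \<equiv> Poly_Mapping.keys"
abbreviation single where "single \<equiv> Poly_Mapping.single"

lemma mdeg_add: "mdeg (a + b) = mdeg a + mdeg b"
  by (simp add: mdeg_def lookup_add sum.distrib)

lemma mdeg_zero [simp]: "mdeg 0 = 0"
  by (simp add: mdeg_def)

lemma mdeg_single [simp]: "mdeg (single i c) = c"
  by (simp add: mdeg_def lookup_single when_def)

lemma finite_mdeg_le: "finite {m :: 'n::finite \<Rightarrow>\<^sub>0 nat. mdeg m \<le> e}"
proof -
  have "lookup m i \<le> e" if "mdeg m \<le> e" for m :: "'n \<Rightarrow>\<^sub>0 nat" and i
    using that member_le_sum[of i UNIV "lookup m"] by (simp add: mdeg_def)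
  then have "lookup ` {m :: 'n \<Rightarrow>\<^sub>0 nat. mdeg m \<le> e} \<subseteq> PiE UNIV (\<lambda>_. {..e})"
    by auto
  then have "finite (lookup ` {m :: 'n \<Rightarrow>\<^sub>0 nat. mdeg m \<le> e})"
    by (rule finite_subset) (simp add: finite_PiE)
  then show ?thesis
    by (rule finite_imageD) (auto intro: inj_onI poly_mapping_eqI)
qed

text \<open>Used to split a monomial at a prescribed degree: for the powers of the maximal ideal,
  and for the cofactor in the division step.\<close>

lemma exponent_split:
  fixes m :: "'n::finite \<Rightarrow>\<^sub>0 nat"
  assumes "e \<le> mdeg m"
  shows "\<exists>a b. m = a + b \<and> mdeg a = e"
  using assms
proof (induction e)
  case 0
  have "m = 0 + m" by simp
  then show ?case using mdeg_zero by blast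
next
  case (Suc e)
  then obtain a b where ab: "m = a + b" "mdeg a = e" by auto
  with Suc.prems have "mdeg b \<noteq> 0" by (simp add: mdeg_add)
  then obtain i where i: "lookup b i \<noteq> 0" by (auto simp: mdeg_def)
  \<comment> \<open>Subtraction of exponents is truncated; since the exponent of \<open>i\<close> is
    nonzero, nothing is lost here.\<close>
  define b' where "b' = b - single i 1"
  have "b = single i 1 + b'"
    by (rule poly_mapping_eqI) (use i in \<open>auto simp: b'_def lookup_add lookup_minus lookup_single when_def\<close>)
  then have "m = (a + single i 1) + b'" using ab by (simp add: add.assoc)
  moreover have "mdeg (a + single i 1) = Suc e" using ab(2) by (simp add: mdeg_add)
  ultimately show ?case by blast
qed

lemma poly_mapping_sum_single: "f = (\<Sum>m\<in>keys f. single m (lookup f m))"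
proof (rule poly_mapping_eqI)
  fix k
  have "lookup (\<Sum>m\<in>keys f. single m (lookup f m)) k = (\<Sum>m\<in>keys f. if m = k then lookup f m else 0)"
    by (simp add: lookup_sum lookup_single when_def)
  then show "lookup f k = lookup (\<Sum>m\<in>keys f. single m (lookup f m)) k"
    by (simp add: in_keys_iff)
qed

text \<open>The \<open>e\<close>-th power of the maximal ideal, described by supports so that
  membership can be checked coefficient by coefficient.\<close>

definition poly_ge :: "nat \<Rightarrow> ('n::finite, 'k::field) mpoly set" where
  "poly_ge e = {f. \<forall>m\<in>keys f. e \<le> mdeg m}"

lemma poly_ge_lookup: "f \<in> poly_ge e \<longleftrightarrow> (\<forall>m. lookup f m \<noteq> 0 \<longrightarrow> e \<le> mdeg m)"
  by (auto simp: poly_ge_def in_keys_iff)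

lemma poly_ge_0 [simp]: "poly_ge 0 = UNIV"
  by (simp add: poly_ge_def)

lemma poly_ge_mult: "f \<in> poly_ge i \<Longrightarrow> g \<in> poly_ge j \<Longrightarrow> f * g \<in> poly_ge (i + j)"
  using keys_mult[of f g] by (fastforce simp: poly_ge_def mdeg_add intro: add_mono)

lemma subspace_poly_ge: "module.subspace (*) (poly_ge e)"
proof -
  have "f + g \<in> poly_ge e" if "f \<in> poly_ge e" "g \<in> poly_ge e" for f g :: "('n::finite, 'k::field) mpoly"
    using that keys_add[of f g] by (fastforce simp: poly_ge_def)
  moreover have "f * g \<in> poly_ge e" if "g \<in> poly_ge e" for f g :: "('n::finite, 'k::field) mpoly"
    using that poly_ge_mult[of f 0 g e] by simp
  ultimately show ?thesis
    by (intro pm.subspaceI) (simp_all add: poly_ge_def)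
qed

lemma single_in_poly_ge: "e \<le> mdeg m \<Longrightarrow> single m c \<in> poly_ge e"
  by (auto simp: poly_ge_def split: if_splits)

lemma max_ideal_eq: "max_ideal = poly_ge 1"
proof
  show "max_ideal \<subseteq> poly_ge 1" unfolding max_ideal_def
    by (rule pm.span_minimal[OF _ subspace_poly_ge]) (auto simp: var_def intro!: single_in_poly_ge)
next
  show "poly_ge 1 \<subseteq> (max_ideal :: ('n::finite, 'k::field) mpoly set)"
  proof
    fix f :: "('n, 'k) mpoly" assume f: "f \<in> poly_ge 1"
    have "single m c \<in> (max_ideal :: ('n, 'k) mpoly set)" if "1 \<le> mdeg m" for m c
    proof -
      from that have "mdeg m \<noteq> 0" by simp
      then obtain i where i: "lookup m i \<noteq> 0" by (auto simp: mdeg_def)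
      define b where "b = m - single i 1"
      have "m = b + single i 1"
        by (rule poly_mapping_eqI) (use i in \<open>auto simp: b_def lookup_add lookup_minus lookup_single when_def\<close>)
      then have "single m c = single b c * (var i :: ('n, 'k) mpoly)"
        by (simp add: var_def mult_single)
      then show ?thesis
        unfolding max_ideal_def by (metis pm.span_base pm.span_scale rangeI)
    qed
    then have "(\<Sum>m\<in>keys f. single m (lookup f m)) \<in> max_ideal" using f
      unfolding max_ideal_def by (intro pm.span_sum) (auto simp: poly_ge_def)
    then show "f \<in> max_ideal" by (simp flip: poly_mapping_sum_single)
  qed
qed

lemma ideal_smult_base: "a \<in> I \<Longrightarrow> x \<in> N \<Longrightarrow> fscale a x \<in> ideal_smult fscale I N"
  unfolding ideal_smult_def by (rule fs.span_base) blast

lemma subspace_ideal_smult: "module.subspace fscale (ideal_smult fscale I N)"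
  unfolding ideal_smult_def by (rule fs.subspace_span)

lemma ideal_smult_minimal:
  assumes "module.subspace fscale T" "\<And>a x. a \<in> I \<Longrightarrow> x \<in> N \<Longrightarrow> fscale a x \<in> T"
  shows "ideal_smult fscale I N \<subseteq> T"
  unfolding ideal_smult_def by (rule fs.span_minimal) (use assms in auto)

text \<open>Polynomials are treated monomial by monomial: one of degree at least
  \<open>Suc e\<close> is the product of a monomial of degree 1 and one of degree at least
  \<open>e\<close>.\<close>

lemma ideal_pow_max_ideal: "ideal_pow max_ideal e = poly_ge e"
proof (induction e)
  case (Suc e)
  have "ideal_smult (*) (poly_ge 1) (poly_ge e) = (poly_ge (Suc e) :: ('a, 'b) mpoly set)"
  proof
    show "ideal_smult (*) (poly_ge 1) (poly_ge e) \<subseteq> (poly_ge (Suc e) :: ('a, 'b) mpoly set)"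
      unfolding ideal_smult_def
    proof (rule pm.span_minimal[OF _ subspace_poly_ge], safe)
      fix a x :: "('a, 'b) mpoly" assume "a \<in> poly_ge 1" "x \<in> poly_ge e"
      then show "a * x \<in> poly_ge (Suc e)" using poly_ge_mult[of a 1 x e] by simp
    qed
    show "(poly_ge (Suc e) :: ('a, 'b) mpoly set) \<subseteq> ideal_smult (*) (poly_ge 1) (poly_ge e)"
    proof
      fix f :: "('a, 'b) mpoly" assume f: "f \<in> poly_ge (Suc e)"
      have "single m c \<in> ideal_smult (*) (poly_ge 1) (poly_ge e :: ('a, 'b) mpoly set)"
        if "Suc e \<le> mdeg m" for m c
      proof -
        from that have "1 \<le> mdeg m" by simp
        then obtain a b where "m = a + b" "mdeg a = 1" using exponent_split by blast
        then have "single m c = single a 1 * (single b c :: ('a, 'b) mpoly)"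
          "e \<le> mdeg b" using that by (simp_all add: mult_single mdeg_add)
        then show ?thesis using \<open>mdeg a = 1\<close>
          unfolding ideal_smult_def by (metis (mono_tags, lifting) mem_Collect_eq order_refl pm.span_base single_in_poly_ge)
      qed
      then have "(\<Sum>m\<in>keys f. single m (lookup f m)) \<in> ideal_smult (*) (poly_ge 1) (poly_ge e)" using f
        unfolding ideal_smult_def by (intro pm.span_sum) (auto simp: poly_ge_def)
      then show "f \<in> ideal_smult (*) (poly_ge 1) (poly_ge e)" by (simp flip: poly_mapping_sum_single)
    qed
  qed
  then show ?case using Suc by (simp add: max_ideal_eq)
qed simp

section \<open>Graded free modules\<close>

abbreviation basis_vec :: "nat \<Rightarrow> (nat \<Rightarrow>\<^sub>0 'r::comm_ring_1)" where
  "basis_vec i \<equiv> single i 1"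

lemma fscale_single: "fscale a (single i c) = single i (a * c)"
  by (rule poly_mapping_eqI) (simp add: lookup_fscale lookup_single when_def)

lemma free_mod_lookup: "x \<in> free_mod b \<longleftrightarrow> (\<forall>i. lookup x i \<noteq> 0 \<longrightarrow> i < b)"
  by (auto simp: free_mod_def in_keys_iff)

lemma subspace_free_mod: "module.subspace fscale (free_mod b)"
proof (rule fs.subspaceI)
  show "0 \<in> free_mod b" by (simp add: free_mod_def)
  show "x + y \<in> free_mod b" if "x \<in> free_mod b" "y \<in> free_mod b" for x y :: "nat \<Rightarrow>\<^sub>0 'a"
    using that keys_add[of x y] by (auto simp: free_mod_def)
  show "fscale c x \<in> free_mod b" if "x \<in> free_mod b" for c and x :: "nat \<Rightarrow>\<^sub>0 'a"
    unfolding free_mod_lookup lookup_fscale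
  proof (intro allI impI)
    fix i assume "c * lookup x i \<noteq> 0"
    then have "lookup x i \<noteq> 0" by auto
    then show "i < b" using that by (simp add: free_mod_lookup)
  qed
qed

lemma basis_vec_in_free_mod: "i < b \<Longrightarrow> basis_vec i \<in> free_mod b"
  by (auto simp: free_mod_lookup lookup_single when_def)

lemma expand_basis: "x = (\<Sum>i\<in>keys x. fscale (lookup x i) (basis_vec i))"
  by (subst poly_mapping_sum_single) (simp add: fscale_single)

definition free_ge :: "nat \<Rightarrow> nat \<Rightarrow> (nat \<Rightarrow>\<^sub>0 ('n::finite, 'k::field) mpoly) set" where
  "free_ge b e = {x \<in> free_mod b. \<forall>i. lookup x i \<in> poly_ge e}"

lemma subspace_free_ge: "module.subspace fscale (free_ge b e)"
  using subspace_free_mod[of b]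
  by (intro fs.subspaceI)
    (auto simp: free_ge_def lookup_fscale lookup_add
      intro: fs.subspace_0 fs.subspace_add fs.subspace_scale pm.subspace_0[OF subspace_poly_ge]
        pm.subspace_add[OF subspace_poly_ge] pm.subspace_scale[OF subspace_poly_ge])

lemma ideal_smult_poly_ge_free_mod:
  "ideal_smult fscale (poly_ge e) (free_mod b) = (free_ge b e :: (nat \<Rightarrow>\<^sub>0 ('n::finite, 'k::field) mpoly) set)"
proof
  show "ideal_smult fscale (poly_ge e) (free_mod b) \<subseteq> (free_ge b e :: (nat \<Rightarrow>\<^sub>0 ('n, 'k) mpoly) set)"
  proof (rule ideal_smult_minimal[OF subspace_free_ge])
    fix a :: "('n, 'k) mpoly" and x :: "nat \<Rightarrow>\<^sub>0 ('n, 'k) mpoly"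
    assume "a \<in> poly_ge e" "x \<in> free_mod b"
    then show "fscale a x \<in> free_ge b e"
      using fs.subspace_scale[OF subspace_free_mod, of x b a] poly_ge_mult[of a e _ 0]
      by (auto simp: free_ge_def lookup_fscale)
  qed
next
  show "(free_ge b e :: (nat \<Rightarrow>\<^sub>0 ('n, 'k) mpoly) set) \<subseteq> ideal_smult fscale (poly_ge e) (free_mod b)"
  proof
    fix x :: "nat \<Rightarrow>\<^sub>0 ('n, 'k) mpoly" assume x: "x \<in> free_ge b e"
    have "(\<Sum>i\<in>keys x. fscale (lookup x i) (basis_vec i)) \<in> ideal_smult fscale (poly_ge e) (free_mod b)"
      by (rule fs.subspace_sum[OF subspace_ideal_smult], rule ideal_smult_base)
        (use x in \<open>auto simp: free_ge_def free_mod_def intro: basis_vec_in_free_mod\<close>)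
    then show "x \<in> ideal_smult fscale (poly_ge e) (free_mod b)"
      by (simp flip: expand_basis)
  qed
qed

lemma ideal_smult_max_ideal_free_mod: "ideal_smult fscale max_ideal (free_mod b) = free_ge b 1"
  by (simp add: max_ideal_eq ideal_smult_poly_ge_free_mod)

text \<open>Letting \<open>i\<close> range over all positions is harmless because the coordinates
  from \<open>b\<close> on vanish; no side condition \<open>i < b\<close> has to be carried
  along.\<close>

lemma free_gr_lookup:
  "x \<in> free_gr b d k \<longleftrightarrow> x \<in> free_mod b \<and>
     (\<forall>i m. lookup (lookup x i) m \<noteq> 0 \<longrightarrow> int (mdeg m) + d i = k)"
proof -
  have "(\<forall>i<b. lookup x i \<in> poly_gr (k - d i)) \<longleftrightarrow>
      (\<forall>i m. lookup (lookup x i) m \<noteq> 0 \<longrightarrow> int (mdeg m) + d i = k)" if x: "x \<in> free_mod b"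
  proof -
    have "i < b" if "lookup (lookup x i) m \<noteq> 0" for i m
      using x that unfolding free_mod_lookup by (metis lookup_zero)
    then show ?thesis by (auto simp: poly_gr_def in_keys_iff eq_diff_eq)
  qed
  then show ?thesis by (auto simp: free_gr_def)
qed

lemma free_gr_sub: "free_gr b d k \<subseteq> free_mod b"
  by (auto simp: free_gr_def)

lemma basis_vec_in_free_gr: "i < b \<Longrightarrow> basis_vec i \<in> free_gr b d (d i)"
  by (auto simp: free_gr_lookup basis_vec_in_free_mod lookup_single lookup_one when_def split: if_splits)

lemma free_gr_zero [simp]: "0 \<in> free_gr b d k"
  by (auto simp: free_gr_lookup free_mod_lookup)

lemma free_gr_add: "x \<in> free_gr b d k \<Longrightarrow> y \<in> free_gr b d k \<Longrightarrow> x + y \<in> free_gr b d k"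
  using fs.subspace_add[OF subspace_free_mod]
  unfolding free_gr_lookup lookup_add by (metis add_0)

lemma free_gr_diff: "x \<in> free_gr b d k \<Longrightarrow> y \<in> free_gr b d k \<Longrightarrow> x - y \<in> free_gr b d k"
  using fs.subspace_diff[OF subspace_free_mod]
  unfolding free_gr_lookup lookup_minus by (metis diff_0_right)

lemma free_gr_sum: "(\<And>i. i \<in> I \<Longrightarrow> f i \<in> free_gr b d k) \<Longrightarrow> sum f I \<in> free_gr b d k"
  by (induction I rule: infinite_finite_induct) (auto intro: free_gr_add)

lemma free_gr_fscale:
  assumes "a \<in> poly_gr e" "x \<in> free_gr b d k"
  shows "fscale a x \<in> free_gr b d (e + k)"
proof -
  have "int (mdeg m) + d i = e + k" if nz: "lookup (a * lookup x i) m \<noteq> 0" for i m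
  proof -
    from nz have "m \<in> keys (a * lookup x i)" by (simp add: in_keys_iff)
    then obtain u v where uv: "m = u + v" "u \<in> keys a" "v \<in> keys (lookup x i)"
      using keys_mult by blast
    then show ?thesis using assms by (force simp: free_gr_lookup poly_gr_def mdeg_add in_keys_iff)
  qed
  then show ?thesis using assms(2) fs.subspace_scale[OF subspace_free_mod]
    by (auto simp: free_gr_lookup lookup_fscale)
qed

lemma single_in_poly_gr: "single m c \<in> poly_gr (int (mdeg m))"
  by (auto simp: poly_gr_def split: if_splits)

section \<open>Homogeneous components in free modules\<close>

definition hcomp ::
  "(nat \<Rightarrow> int) \<Rightarrow> int \<Rightarrow> (nat \<Rightarrow>\<^sub>0 ('n::finite, 'k::field) mpoly) \<Rightarrow> (nat \<Rightarrow>\<^sub>0 ('n, 'k) mpoly)" where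
  "hcomp d k x = Poly_Mapping.mapp (\<lambda>i. Poly_Mapping.mapp (\<lambda>m c. c when int (mdeg m) + d i = k)) x"

lemma lookup_hcomp:
  "lookup (lookup (hcomp d k x) i) m = (lookup (lookup x i) m when int (mdeg m) + d i = k)"
  by (auto simp: hcomp_def lookup_mapp when_def in_keys_iff)

lemma poly_mapping_coeff_eqI: "(\<And>i m. lookup (lookup x i) m = lookup (lookup y i) m) \<Longrightarrow> x = y"
  by (intro poly_mapping_eqI)

lemma hcomp_in_free_gr: "x \<in> free_mod b \<Longrightarrow> hcomp d k x \<in> free_gr b d k"
proof -
  assume x: "x \<in> free_mod b"
  have "keys (hcomp d k x) \<subseteq> keys x"
    unfolding hcomp_def by (rule keys_mapp_subset)
  then show ?thesis
    using x by (auto simp: free_gr_lookup free_mod_def lookup_hcomp)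
qed

lemma hcomp_sum: "hcomp d k (\<Sum>i\<in>I. f i) = (\<Sum>i\<in>I. hcomp d k (f i))"
proof (rule poly_mapping_coeff_eqI)
  fix i m
  show "lookup (lookup (hcomp d k (\<Sum>i\<in>I. f i)) i) m = lookup (lookup (\<Sum>i\<in>I. hcomp d k (f i)) i) m"
    by (induction I rule: infinite_finite_induct) (auto simp: lookup_hcomp lookup_add when_def)
qed

lemma hcomp_homogeneous: "x \<in> free_gr b d k \<Longrightarrow> hcomp d k' x = (if k' = k then x else 0)"
  by (rule poly_mapping_coeff_eqI) (auto simp: lookup_hcomp free_gr_lookup when_def)

text \<open>The last clause allows a sum over \<open>K\<close> to be evaluated at any degree,
  whether or not it belongs to \<open>K\<close>.\<close>

lemma hcomp_decomposition:
  obtains K where "finite K" "x = (\<Sum>k\<in>K. hcomp d k x)" "\<forall>k. k \<notin> K \<longrightarrow> hcomp d k x = 0"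
proof
  define K where "K = (\<Union>i\<in>keys x. (\<lambda>m. int (mdeg m) + d i) ` keys (lookup x i))"
  show "finite K" by (simp add: K_def)
  have K: "int (mdeg m) + d i \<in> K" if "lookup (lookup x i) m \<noteq> 0" for i m
  proof -
    from that have "i \<in> keys x" "m \<in> keys (lookup x i)" by (auto simp: in_keys_iff)
    then show ?thesis by (auto simp: K_def)
  qed
  have "hcomp d k x = 0" if "k \<notin> K" for k
    using that K by (intro poly_mapping_coeff_eqI) (auto simp: lookup_hcomp when_def)
  then show "\<forall>k. k \<notin> K \<longrightarrow> hcomp d k x = 0" by blast
  show "x = (\<Sum>k\<in>K. hcomp d k x)"
  proof (rule poly_mapping_coeff_eqI)
    fix i m
    have "lookup (lookup (\<Sum>k\<in>K. hcomp d k x) i) m = (\<Sum>k\<in>K. if k = int (mdeg m) + d i then lookup (lookup x i) m else 0)"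
      by (auto simp: lookup_sum lookup_hcomp when_def intro!: sum.cong)
    then show "lookup (lookup x i) m = lookup (lookup (\<Sum>k\<in>K. hcomp d k x) i) m"
      using K[of i m] \<open>finite K\<close> by auto
  qed
qed

lemma hcomp_free_ge: "x \<in> free_ge b e \<Longrightarrow> hcomp d k x \<in> free_ge b e"
  using hcomp_in_free_gr[of x b d k] free_gr_sub[of b d k]
  by (auto simp: free_ge_def poly_ge_lookup lookup_hcomp when_def split: if_splits)

section \<open>Dickson's lemma and the Artin--Rees lemma\<close>

text \<open>When a coordinate \<open>i\<close> is added, a finite set for the old coordinates
  already dominates from below every \<open>f\<close> whose value at \<open>i\<close> is large
  enough. The remaining \<open>f\<close> lie in finitely many slices on which the value at
  \<open>i\<close> is constant, and the induction hypothesis applies to each slice.\<close>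

lemma dickson:
  fixes A :: "('a \<Rightarrow> nat) set"
  assumes "finite I"
  shows "\<exists>B. finite B \<and> B \<subseteq> A \<and> (\<forall>f\<in>A. \<exists>g\<in>B. \<forall>i\<in>I. g i \<le> f i)"
  using assms
proof (induction I arbitrary: A rule: finite_induct)
  case empty
  show ?case
  proof (cases "A = {}")
    case False
    then obtain f where "f \<in> A" by blast
    then show ?thesis by (intro exI[of _ "{f}"]) simp
  qed simp
next
  case (insert i I)
  obtain B0 where B0: "finite B0" "B0 \<subseteq> A" "\<And>f. f \<in> A \<Longrightarrow> \<exists>g\<in>B0. \<forall>i\<in>I. g i \<le> f i"
    using insert.IH[of A] by blast
  have "\<exists>C. \<forall>n. finite (C n) \<and> C n \<subseteq> {f \<in> A. f i = n} \<and>
      (\<forall>f\<in>{f \<in> A. f i = n}. \<exists>g\<in>C n. \<forall>i\<in>I. g i \<le> f i)"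
    by (intro choice allI insert.IH)
  then obtain C where C': "\<forall>n. finite (C n) \<and> C n \<subseteq> {f \<in> A. f i = n} \<and>
      (\<forall>f\<in>{f \<in> A. f i = n}. \<exists>g\<in>C n. \<forall>i\<in>I. g i \<le> f i)"
    by (elim exE)
  have C: "finite (C n)" "C n \<subseteq> {f \<in> A. f i = n}"
      "f \<in> A \<Longrightarrow> f i = n \<Longrightarrow> \<exists>g\<in>C n. \<forall>i\<in>I. g i \<le> f i" for n f
    using C'[rule_format, of n] by simp_all
  \<comment> \<open>Any upper bound for the values at \<open>i\<close> on \<open>B0\<close> would
    serve; the sum also covers an empty \<open>B0\<close>.\<close>
  define M where "M = (\<Sum>g\<in>B0. g i)"
  let ?B = "B0 \<union> (\<Union>n<M. C n)"
  have "\<exists>g\<in>?B. \<forall>k\<in>insert i I. g k \<le> f k" if f: "f \<in> A" for f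
  proof (cases "f i < M")
    case True
    obtain g where "g \<in> C (f i)" "\<forall>k\<in>I. g k \<le> f k" using C(3)[OF f refl] by blast
    moreover from this have "g i = f i" using C(2) by blast
    ultimately show ?thesis using True by (intro bexI[of _ g]) auto
  next
    case False
    obtain g where g: "g \<in> B0" "\<forall>k\<in>I. g k \<le> f k" using B0(3)[OF f] by blast
    then have "g i \<le> M" unfolding M_def using B0(1) by (intro member_le_sum) auto
    with False g show ?thesis by (intro bexI[of _ g]) auto
  qed
  moreover have "finite ?B" using B0 C by auto
  moreover have "?B \<subseteq> A" using B0(2) C(2) by blast
  ultimately show ?case by blast
qed

text \<open>Monomials divide each other only within one position, so Dickson's lemma is applied to
  each of the \<open>b\<close> positions separately.\<close>

lemma dickson_free:
  fixes A :: "(nat \<times> ('n::finite \<Rightarrow>\<^sub>0 nat)) set"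
  assumes "\<And>l m. (l, m) \<in> A \<Longrightarrow> l < b"
  shows "\<exists>B. finite B \<and> B \<subseteq> A \<and> (\<forall>(l, m)\<in>A. \<exists>a c. (l, a) \<in> B \<and> m = a + c)"
proof -
  have "\<exists>B. \<forall>l. finite (B l) \<and> B l \<subseteq> lookup ` {m. (l, m) \<in> A} \<and>
      (\<forall>f\<in>lookup ` {m. (l, m) \<in> A}. \<exists>g\<in>B l. \<forall>i\<in>UNIV. g i \<le> f i)"
    by (intro choice allI dickson) simp
  then obtain B where B': "\<forall>l. finite (B l) \<and> B l \<subseteq> lookup ` {m. (l, m) \<in> A} \<and>
      (\<forall>f\<in>lookup ` {m. (l, m) \<in> A}. \<exists>g\<in>B l. \<forall>i\<in>UNIV. g i \<le> f i)"
    by (elim exE)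
  have B: "finite (B l)" "B l \<subseteq> lookup ` {m. (l, m) \<in> A}"
      "f \<in> lookup ` {m. (l, m) \<in> A} \<Longrightarrow> \<exists>g\<in>B l. \<forall>i. g i \<le> f i" for l f
    using B'[rule_format, of l] by auto
  define C where "C = (\<Union>l<b. Pair l ` (lookup -` B l))"
  have inj: "inj (lookup :: ('n \<Rightarrow>\<^sub>0 nat) \<Rightarrow> _)" by (auto intro: injI poly_mapping_eqI)
  have "finite C" unfolding C_def using B(1) inj by (auto intro!: finite_imageI finite_vimageI)
  moreover have "C \<subseteq> A"
  proof
    fix p assume "p \<in> C"
    then obtain l a where p: "p = (l, a)" "lookup a \<in> B l" by (auto simp: C_def)
    with B(2) obtain m where "(l, m) \<in> A" "lookup a = lookup m" by blast
    then show "p \<in> A" using p(1) injD[OF inj] by blast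
  qed
  moreover have "\<exists>a c. (l, a) \<in> C \<and> m = a + c" if lm: "(l, m) \<in> A" for l m
  proof -
    from lm have "lookup m \<in> lookup ` {m. (l, m) \<in> A}" by blast
    from B(3)[OF this] obtain g where g: "g \<in> B l" "\<And>i. g i \<le> lookup m i" by blast
    from g(1) B(2) obtain a where a: "g = lookup a" by blast
    have "m = a + (m - a)"
      by (rule poly_mapping_eqI) (use g(2) a in \<open>simp add: lookup_add lookup_minus\<close>)
    moreover have "(l, a) \<in> C" using g(1) a assms[OF lm] by (auto simp: C_def)
    ultimately show ?thesis by blast
  qed
  ultimately show ?thesis by (intro exI[of _ C]) auto
qed

text \<open>A total order on the monomials \<open>(l, m)\<close> of a free module that refines the total degree of
  \<open>m\<close> (not its shifted degree) and is compatible with multiplication: the code of a monomial lists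
  first its degree, then its position, then its exponents, and codes are compared
  lexicographically. Leading terms are the minimal ones, so that they detect the order of an
  element with respect to the \<open>\<mm>\<close>-adic filtration.\<close>

definition mon_code :: "nat \<times> ('n::finite \<Rightarrow>\<^sub>0 nat) \<Rightarrow> (nat \<Rightarrow>\<^sub>0 nat)" where
  "mon_code p = single 0 (mdeg (snd p)) + single 1 (fst p) +
     (\<Sum>i\<in>UNIV. single ((SOME e. inj e) i + 2) (lookup (snd p) i))"

text \<open>Multiplication by a monomial adds one fixed code, independent of the term it acts on, so
  it preserves the order. Position 0 in the last code contributes nothing to slot 1.\<close>

lemma mon_code_add: "mon_code (l, m + a) = mon_code (l, m) + mon_code (0, a)"
  by (simp add: mon_code_def mdeg_add lookup_add single_add sum.distrib algebra_simps)

lemma mon_code_inj: "mon_code p = mon_code q \<Longrightarrow> p = q"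
proof -
  assume eq: "mon_code p = mon_code q"
  \<comment> \<open>This is the numbering of the variables chosen inside \<open>mon_code\<close>.
    Its injectivity keeps their slots apart; the offset 2 reserves slots 0 and 1 for degree and
    position.\<close>
  define e where "e = (SOME e :: 'a \<Rightarrow> nat. inj e)"
  have "\<exists>e :: 'a \<Rightarrow> nat. inj e" using finite_imp_inj_to_nat_seg[of "UNIV :: 'a set"] by auto
  then have e: "inj e" unfolding e_def by (rule someI_ex)
  have 1: "lookup (mon_code p) 1 = fst p" for p :: "nat \<times> ('a \<Rightarrow>\<^sub>0 nat)"
    by (simp add: mon_code_def lookup_add lookup_sum lookup_single when_def)
  have 2: "lookup (mon_code p) (e i + 2) = lookup (snd p) i" for p :: "nat \<times> ('a \<Rightarrow>\<^sub>0 nat)" and i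
    by (simp add: mon_code_def lookup_add lookup_sum lookup_single when_def inj_eq[OF e] flip: e_def)
  from eq 1[of p] 1[of q] 2[of p] 2[of q] show "p = q"
    by (intro prod_eqI poly_mapping_eqI) simp_all
qed

lemma mon_code_mdeg:
  fixes m m' :: "'n::finite \<Rightarrow>\<^sub>0 nat"
  shows "mon_code (l, m) \<le> mon_code (l', m') \<Longrightarrow> mdeg m \<le> mdeg m'"
proof (rule ccontr)
  assume le: "mon_code (l, m) \<le> mon_code (l', m')" and "\<not> mdeg m \<le> mdeg m'"
  have 0: "lookup (mon_code p) 0 = mdeg (snd p)" for p :: "nat \<times> ('n \<Rightarrow>\<^sub>0 nat)"
    by (simp add: mon_code_def lookup_add lookup_sum lookup_single when_def)
  \<comment> \<open>Slot 0 is compared first, so a difference in degree already decides the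
    order.\<close>
  have "lookup (mon_code (l', m')) 0 < lookup (mon_code (l, m)) 0"
    using \<open>\<not> mdeg m \<le> mdeg m'\<close> by (simp only: 0 snd_conv not_le)
  then have "mon_code (l', m') < mon_code (l, m)"
    unfolding less_poly_mapping.rep_eq by (intro less_funI exI[of _ 0]) auto
  with le show False by simp
qed

section \<open>Monomials and leading terms in free modules\<close>

definition mons :: "(nat \<Rightarrow>\<^sub>0 ('n::finite, 'k::field) mpoly) \<Rightarrow> (nat \<times> ('n \<Rightarrow>\<^sub>0 nat)) set" where
  "mons x = {(l, m). lookup (lookup x l) m \<noteq> 0}"

lemma finite_mons: "finite (mons x)"
proof (rule finite_subset)
  show "mons x \<subseteq> Sigma (keys x) (\<lambda>l. keys (lookup x l))"
    by (auto simp: mons_def in_keys_iff)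
qed (simp add: finite_SigmaI)

lemma mons_empty: "mons x = {} \<longleftrightarrow> x = 0"
  by (auto simp: mons_def intro!: poly_mapping_coeff_eqI)

lemma free_ge_mons: "x \<in> free_ge b e \<longleftrightarrow> x \<in> free_mod b \<and> (\<forall>(l, m)\<in>mons x. e \<le> mdeg m)"
  by (auto simp: free_ge_def mons_def poly_ge_lookup)

lemma lookup_mult_single:
  fixes f :: "('n, 'k::field) mpoly"
  shows "lookup (single c a * f) (m + c) = a * lookup f m"
proof -
  have "single c a * f = (\<Sum>u\<in>keys f. single (c + u) (a * lookup f u))"
    by (subst poly_mapping_sum_single[of f]) (simp add: sum_distrib_left mult_single)
  then show ?thesis
    by (simp add: lookup_sum lookup_single when_def add.commute[of m] in_keys_iff)
qed

lemma mons_mult: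
  assumes "p \<in> mons (fscale (single c a) x)"
  obtains l m where "p = (l, m + c)" "(l, m) \<in> mons x"
proof -
  obtain l m' where p: "p = (l, m')" by (cases p)
  with assms have "m' \<in> keys (single c a * lookup x l)" by (simp add: mons_def lookup_fscale in_keys_iff)
  then obtain m where "m' = c + m" "m \<in> keys (lookup x l)"
    using keys_mult[of "single c a" "lookup x l"] by (auto split: if_splits)
  then show ?thesis using that[of l m] p by (simp add: mons_def in_keys_iff add.commute)
qed

definition lead :: "nat \<times> ('n::finite \<Rightarrow>\<^sub>0 nat) \<Rightarrow> (nat \<Rightarrow>\<^sub>0 ('n, 'k::field) mpoly) \<Rightarrow> bool" where
  "lead p x \<longleftrightarrow> p \<in> mons x \<and> (\<forall>q\<in>mons x. mon_code p \<le> mon_code q)"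

lemma lead_exists:
  assumes "x \<noteq> 0"
  obtains p where "lead p x"
proof -
  have "finite (mon_code ` mons x)" "mon_code ` mons x \<noteq> {}"
    using assms by (simp_all add: finite_mons mons_empty)
  from Min_in[OF this] obtain p where p: "p \<in> mons x" "mon_code p = Min (mon_code ` mons x)"
    by (auto simp del: Min_in)
  show ?thesis
  proof (rule that)
    show "lead p x"
      unfolding lead_def p(2) using p(1) by (simp add: finite_mons)
  qed
qed

text \<open>Gives both the termination of the division and the finite dimension of the graded pieces
  that enter the Betti numbers.\<close>

lemma finite_degree_monomials:
  "finite {(l :: nat, m :: 'n::finite \<Rightarrow>\<^sub>0 nat). l < b \<and> int (mdeg m) + d l = k}"
proof (rule finite_subset)
  show "{(l :: nat, m :: 'n \<Rightarrow>\<^sub>0 nat). l < b \<and> int (mdeg m) + d l = k}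
      \<subseteq> Sigma {..<b} (\<lambda>l. {m. mdeg m \<le> nat (k - d l)})"
    by auto
qed (intro finite_SigmaI finite_mdeg_le finite_lessThan)

lemma mons_free_gr:
  "x \<in> free_gr b d k \<Longrightarrow> mons x \<subseteq> {(l, m). l < b \<and> int (mdeg m) + d l = k}"
  by (auto simp: mons_def free_gr_lookup free_mod_lookup) (metis lookup_zero)

text \<open>Division by elements whose leading monomials generate all leading monomials of \<open>N\<close>. It
  terminates on homogeneous elements because there are finitely many monomials of a given shifted
  degree.\<close>

lemma artin_rees_homogeneous:
  fixes N :: "(nat \<Rightarrow>\<^sub>0 ('n::finite, 'k::field) mpoly) set"
  assumes N: "module.subspace fscale N"
    and B: "\<And>p x k. x \<in> N \<Longrightarrow> x \<in> free_gr b d k \<Longrightarrow> lead p x \<Longrightarrow>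
        \<exists>l a c. p = (l, a + c) \<and> mdeg a \<le> r \<and>
          (\<exists>g k'. g \<in> N \<and> g \<in> free_gr b d k' \<and> lead (l, a) g)"
    and "r \<le> i"
  shows "x \<in> N \<Longrightarrow> x \<in> free_gr b d k \<Longrightarrow> x \<in> free_ge b i \<Longrightarrow>
    x \<in> ideal_smult fscale (poly_ge (i - r)) (N \<inter> free_ge b r)"
\<comment> \<open>The measure counts the monomials of degree \<open>k\<close> whose code is at least
  the leading code of \<open>x\<close>. Cancelling the leading term raises that code, so at least
  the old leading monomial drops out.\<close>
proof (induction "card {q \<in> {(l, m :: 'n \<Rightarrow>\<^sub>0 nat). l < b \<and> int (mdeg m) + d l = k}. \<exists>p\<in>mons x. mon_code p \<le> mon_code q}"
    arbitrary: x rule: less_induct)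
  case less
  let ?S = "{(l, m :: 'n \<Rightarrow>\<^sub>0 nat). l < b \<and> int (mdeg m) + d l = k}"
  let ?J = "ideal_smult fscale (poly_ge (i - r)) (N \<inter> free_ge b r)"
  show ?case
  proof (cases "x = 0")
    case True
    then show ?thesis by (simp add: fs.subspace_0[OF subspace_ideal_smult])
  next
    case False
    then obtain p where p: "lead p x" by (rule lead_exists)
    from B[OF less.prems(1,2) p] obtain l a c g k' where
      pl: "p = (l, a + c)" and a: "mdeg a \<le> r" and g: "g \<in> N" "g \<in> free_gr b d k'" "lead (l, a) g"
      by blast
    from p pl have xp: "lookup (lookup x l) (a + c) \<noteq> 0" by (simp add: lead_def mons_def)
    then have deg: "int (mdeg (a + c)) + d l = k" using less.prems(2) by (auto simp: free_gr_lookup)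
    have ii: "i \<le> mdeg (a + c)"
      using p pl less.prems(3) by (auto simp: free_ge_mons lead_def)
    from g have ga: "lookup (lookup g l) a \<noteq> 0" by (simp add: lead_def mons_def)
    then have k': "k' = int (mdeg a) + d l" using g(2) by (auto simp: free_gr_lookup)
    define t where "t = lookup (lookup x l) (a + c) / lookup (lookup g l) a"
    define y where "y = fscale (single c t) g"
    \<comment> \<open>Of the cofactor \<open>c\<close>, the part \<open>c1\<close> has just the
      degree that brings \<open>g\<close> into \<mm>^r F. The rest \<open>c2\<close> has degree at
      least \<open>i - r\<close> and supplies the coefficient in \<mm>^(i-r).\<close>
    from ii \<open>r \<le> i\<close> a have "r - mdeg a \<le> mdeg c" by (simp add: mdeg_add)
    then obtain c1 c2 where c: "c = c1 + c2" "mdeg c1 = r - mdeg a" using exponent_split by blast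
    \<comment> \<open>Codes compare degrees first, so a leading monomial has least degree and bounds
      the order of all of \<open>g\<close>.\<close>
    have gge: "mdeg a \<le> mdeg m" if "(l', m) \<in> mons g" for l' m
      using g(3) that mon_code_mdeg by (fastforce simp: lead_def)
    have "fscale (single c1 1) g \<in> N \<inter> free_ge b r"
    proof
      show "fscale (single c1 1) g \<in> N" using g(1) by (rule fs.subspace_scale[OF N])
      have "fscale (single c1 1) g \<in> free_mod b"
        using g(2) free_gr_sub by (blast intro: fs.subspace_scale[OF subspace_free_mod])
      moreover have "r \<le> mdeg m" if "(l', m) \<in> mons (fscale (single c1 1) g)" for l' m
        using that by (rule mons_mult) (use gge c(2) in \<open>force simp: mdeg_add\<close>)
      ultimately show "fscale (single c1 1) g \<in> free_ge b r" by (auto simp: free_ge_mons)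
    qed
    moreover have "y = fscale (single c2 t) (fscale (single c1 1) g)"
      by (simp add: y_def c mult_single add.commute)
    moreover have "single c2 t \<in> poly_ge (i - r)"
      using ii c a by (intro single_in_poly_ge) (simp add: mdeg_add)
    ultimately have yJ: "y \<in> ?J" by (simp only: ideal_smult_base)
    have yN: "y \<in> N" unfolding y_def using g(1) by (rule fs.subspace_scale[OF N])
    have ygr: "y \<in> free_gr b d k"
    proof -
      have "int (mdeg c) + k' = k" using deg k' by (simp add: mdeg_add)
      then show ?thesis using free_gr_fscale[OF single_in_poly_gr[of c t] g(2)] by (simp add: y_def)
    qed
    have yge: "y \<in> free_ge b i"
    proof -
      have "i \<le> mdeg m" if "(l', m) \<in> mons y" for l' m
        using that unfolding y_def by (rule mons_mult) (use gge ii in \<open>force simp: mdeg_add\<close>)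
      then show ?thesis using subsetD[OF free_gr_sub ygr] by (auto simp: free_ge_mons)
    qed
    have yp: "mon_code p \<le> mon_code q" if "q \<in> mons y" for q
    proof -
      obtain l' m where q: "q = (l', m + c)" "(l', m) \<in> mons g"
        using \<open>q \<in> mons y\<close> unfolding y_def by (rule mons_mult)
      then have "mon_code (l, a) \<le> mon_code (l', m)" using g(3) by (simp add: lead_def)
      then show ?thesis by (simp add: pl q mon_code_add add_right_mono)
    qed
    have lp: "lookup (lookup y l) (a + c) = lookup (lookup x l) (a + c)"
      using ga by (simp add: y_def lookup_fscale lookup_mult_single t_def)
    have code: "mon_code p < mon_code q" if q: "q \<in> mons (x - y)" for q
    proof -
      have "mons (x - y) \<subseteq> mons x \<union> mons y" by (auto simp: mons_def lookup_minus)
      then have "mon_code p \<le> mon_code q" using q yp p unfolding lead_def by blast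
      moreover have "p \<notin> mons (x - y)" using lp by (simp add: pl mons_def lookup_minus)
      ultimately show ?thesis using q mon_code_inj[of p q] by (metis order_le_less)
    qed
    have "x - y \<in> ?J"
    proof (rule less.hyps)
      have "{q \<in> ?S. \<exists>p\<in>mons (x - y). mon_code p \<le> mon_code q} \<subset>
          {q \<in> ?S. \<exists>p\<in>mons x. mon_code p \<le> mon_code q}"
      proof (rule psubsetI)
        show "{q \<in> ?S. \<exists>p\<in>mons (x - y). mon_code p \<le> mon_code q} \<subseteq>
            {q \<in> ?S. \<exists>p\<in>mons x. mon_code p \<le> mon_code q}"
          using code p unfolding lead_def by (blast intro: order_trans less_imp_le)
        have "p \<in> {q \<in> ?S. \<exists>p\<in>mons x. mon_code p \<le> mon_code q}"
          using p mons_free_gr[OF less.prems(2)] by (auto simp: lead_def)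
        moreover have "p \<notin> {q \<in> ?S. \<exists>p\<in>mons (x - y). mon_code p \<le> mon_code q}"
          using code by (auto simp: not_le)
        ultimately show "{q \<in> ?S. \<exists>p\<in>mons (x - y). mon_code p \<le> mon_code q} \<noteq>
            {q \<in> ?S. \<exists>p\<in>mons x. mon_code p \<le> mon_code q}" by blast
      qed
      then show "card {q \<in> ?S. \<exists>p\<in>mons (x - y). mon_code p \<le> mon_code q} <
          card {q \<in> ?S. \<exists>p\<in>mons x. mon_code p \<le> mon_code q}"
        by (intro psubset_card_mono finite_subset[OF _ finite_degree_monomials[of b d k]]) auto
      show "x - y \<in> N" using less.prems(1) yN by (rule fs.subspace_diff[OF N])
      show "x - y \<in> free_gr b d k" using less.prems(2) ygr by (rule free_gr_diff)
      show "x - y \<in> free_ge b i"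
        using less.prems(3) yge by (rule fs.subspace_diff[OF subspace_free_ge])
    qed
    then have "(x - y) + y \<in> ?J" using yJ by (rule fs.subspace_add[OF subspace_ideal_smult])
    then show ?thesis by simp
  qed
qed

text \<open>Components of elements of \<open>N\<close> stay in \<open>N\<close> by
  \<open>graded\<close>, so each can be divided on its own. The divisors come from Dickson's lemma,
  applied to the leading monomials of the homogeneous elements of \<open>N\<close>; \<open>r\<close>
  only has to bound their degrees.\<close>

theorem artin_rees_exists:
  fixes N :: "(nat \<Rightarrow>\<^sub>0 ('n::finite, 'k::field) mpoly) set"
  assumes N: "module.subspace fscale N" "N \<subseteq> free_mod b"
    and graded: "\<And>x k. x \<in> N \<Longrightarrow> hcomp d k x \<in> N"
  shows "\<exists>r. \<forall>i\<ge>r. N \<inter> ideal_smult fscale (ideal_pow max_ideal i) (free_mod b) =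
     ideal_smult fscale (ideal_pow max_ideal (i - r))
       (N \<inter> ideal_smult fscale (ideal_pow max_ideal r) (free_mod b))"
proof -
  define L where "L = {p. \<exists>x k. x \<in> N \<and> x \<in> free_gr b d k \<and> lead p x}"
  have "l < b" if "(l, m) \<in> L" for l m
    using that mons_free_gr unfolding L_def lead_def by blast
  then obtain B where B: "finite B" "B \<subseteq> L" "\<forall>(l, m)\<in>L. \<exists>a c. (l, a) \<in> B \<and> m = a + c"
    using dickson_free[of L b] by blast
  \<comment> \<open>Any common upper bound of these degrees serves; the sum avoids a maximum over a
    possibly empty set.\<close>
  define r where "r = (\<Sum>p\<in>B. mdeg (snd p))"
  have r: "mdeg a \<le> r" if "(l, a) \<in> B" for l a
    using member_le_sum[of "(l, a)" B "\<lambda>p. mdeg (snd p)"] that B(1) by (simp add: r_def)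
  have "N \<inter> free_ge b i = ideal_smult fscale (poly_ge (i - r)) (N \<inter> free_ge b r)" if "r \<le> i" for i
  proof
    show "ideal_smult fscale (poly_ge (i - r)) (N \<inter> free_ge b r) \<subseteq> N \<inter> free_ge b i"
    proof (rule ideal_smult_minimal)
      show "module.subspace fscale (N \<inter> free_ge b i)"
        by (rule fs.subspace_inter[OF N(1) subspace_free_ge])
      fix a :: "('n, 'k) mpoly" and x :: "nat \<Rightarrow>\<^sub>0 ('n, 'k) mpoly"
      assume a: "a \<in> poly_ge (i - r)" and x: "x \<in> N \<inter> free_ge b r"
      have "fscale a x \<in> N" using x by (auto intro: fs.subspace_scale[OF N(1)])
      moreover have "a * lookup x l \<in> poly_ge i" for l
        using poly_ge_mult[OF a, of "lookup x l" r] x that by (auto simp: free_ge_def)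
      ultimately show "fscale a x \<in> N \<inter> free_ge b i"
        using N(2) by (auto simp: free_ge_def lookup_fscale)
    qed
    show "N \<inter> free_ge b i \<subseteq> ideal_smult fscale (poly_ge (i - r)) (N \<inter> free_ge b r)"
    proof
      fix x assume x: "x \<in> N \<inter> free_ge b i"
      have "hcomp d k x \<in> ideal_smult fscale (poly_ge (i - r)) (N \<inter> free_ge b r)" for k
      proof (rule artin_rees_homogeneous[OF N(1) _ that])
        show "hcomp d k x \<in> N" using x graded by blast
        show "hcomp d k x \<in> free_gr b d k" using x N(2) hcomp_in_free_gr by blast
        show "hcomp d k x \<in> free_ge b i" using x hcomp_free_ge by blast
        fix p y k' assume y: "y \<in> N" "y \<in> free_gr b d k'" "lead p y"
        obtain l m where p: "p = (l, m)" by (cases p)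
        with y have "(l, m) \<in> L" unfolding L_def by blast
        with B(3) obtain a c where ac: "(l, a) \<in> B" "m = a + c" by blast
        with B(2) have "(l, a) \<in> L" by blast
        then show "\<exists>l a c. p = (l, a + c) \<and> mdeg a \<le> r \<and>
          (\<exists>g k'. g \<in> N \<and> g \<in> free_gr b d k' \<and> lead (l, a) g)"
          using p ac r unfolding L_def by blast
      qed
      moreover obtain K where "x = (\<Sum>k\<in>K. hcomp d k x)" by (rule hcomp_decomposition)
      ultimately show "x \<in> ideal_smult fscale (poly_ge (i - r)) (N \<inter> free_ge b r)"
        using fs.subspace_sum[OF subspace_ideal_smult] by metis
    qed
  qed
  then show ?thesis unfolding ideal_pow_max_ideal ideal_smult_poly_ge_free_mod by blast
qed

text \<open>As \<open>artin_rees\<close> is a LEAST, its defining equation becomes available only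
  through the existence theorem.\<close>

lemma artin_rees_spec:
  fixes N :: "(nat \<Rightarrow>\<^sub>0 ('n::finite, 'k::field) mpoly) set"
  assumes "module.subspace fscale N" "N \<subseteq> free_mod b" "\<And>x k. x \<in> N \<Longrightarrow> hcomp d k x \<in> N"
    and "artin_rees N (free_mod b) \<le> i"
  shows "N \<inter> free_ge b i =
    ideal_smult fscale (poly_ge (i - artin_rees N (free_mod b)))
      (N \<inter> free_ge b (artin_rees N (free_mod b)))"
proof -
  have "\<exists>r. \<forall>i\<ge>r. N \<inter> ideal_smult fscale (ideal_pow max_ideal i) (free_mod b) =
     ideal_smult fscale (ideal_pow max_ideal (i - r))
       (N \<inter> ideal_smult fscale (ideal_pow max_ideal r) (free_mod b))"
    by (rule artin_rees_exists) (fact assms)+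
  from LeastI_ex[OF this, folded artin_rees_def]
  show ?thesis unfolding ideal_pow_max_ideal ideal_smult_poly_ge_free_mod
    by (elim allE[of _ i] impE) (fact assms(4))
qed

section \<open>Comparison of graded free resolutions\<close>

lemma module_hom_sum_basis:
  assumes "module_hom fscale s \<phi>"
  shows "\<phi> x = (\<Sum>i\<in>keys x. s (lookup x i) (\<phi> (basis_vec i)))"
proof -
  interpret module_hom fscale s \<phi> by fact
  have "\<phi> (\<Sum>i\<in>keys x. fscale (lookup x i) (basis_vec i)) = (\<Sum>i\<in>keys x. s (lookup x i) (\<phi> (basis_vec i)))"
    by (simp add: sum scale)
  then show ?thesis by (simp flip: expand_basis)
qed

lemma module_hom_eq_on_free_mod:
  assumes "module_hom fscale s \<phi>" "module_hom fscale s \<psi>"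
    and "\<And>i. i < b \<Longrightarrow> \<phi> (basis_vec i) = \<psi> (basis_vec i)" "x \<in> free_mod b"
  shows "\<phi> x = \<psi> x"
  unfolding module_hom_sum_basis[OF assms(1), of x] module_hom_sum_basis[OF assms(2), of x]
  by (rule sum.cong) (use assms(3,4) in \<open>auto simp: free_mod_def\<close>)

lemma module_hom_free_mod:
  assumes "module_hom fscale fscale \<phi>" "\<And>i. i < b \<Longrightarrow> \<phi> (basis_vec i) \<in> T"
    and "module.subspace fscale T" "x \<in> free_mod b"
  shows "\<phi> x \<in> T"
  unfolding module_hom_sum_basis[OF assms(1), of x]
  by (intro fs.subspace_sum[OF assms(3)] fs.subspace_scale[OF assms(3)])
    (use assms(2,4) in \<open>auto simp: free_mod_def\<close>)

lemma module_hom_free_gr: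
  assumes "module_hom fscale fscale \<phi>" "\<And>i. i < b \<Longrightarrow> \<phi> (basis_vec i) \<in> free_gr b' d' (d i)"
    and x: "x \<in> free_gr b d k"
  shows "\<phi> x \<in> free_gr b' d' k"
  unfolding module_hom_sum_basis[OF assms(1), of x]
proof (rule free_gr_sum)
  fix i assume "i \<in> keys x"
  then have i: "i < b" using x by (auto simp: free_gr_def free_mod_def)
  then have "lookup x i \<in> poly_gr (k - d i)" using x by (simp add: free_gr_def)
  from free_gr_fscale[OF this assms(2)[OF i]]
  show "fscale (lookup x i) (\<phi> (basis_vec i)) \<in> free_gr b' d' k" by simp
qed

text \<open>For \<open>e = 1\<close> this lets chain maps, differentials and homotopies descend to
  F/\<mm>F.\<close>

lemma module_hom_free_ge:
  assumes "module_hom fscale fscale \<phi>" "\<phi> ` free_mod b \<subseteq> free_mod b'" and x: "x \<in> free_ge b e"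
  shows "\<phi> x \<in> free_ge b' e"
  unfolding module_hom_sum_basis[OF assms(1), of x]
proof (rule fs.subspace_sum[OF subspace_free_ge])
  fix i assume "i \<in> keys x"
  then have i: "i < b" using x by (auto simp: free_ge_def free_mod_def)
  then have "\<phi> (basis_vec i) \<in> free_mod b'" using assms(2) basis_vec_in_free_mod by blast
  moreover have "lookup x i \<in> poly_ge e" using x by (simp add: free_ge_def)
  ultimately show "fscale (lookup x i) (\<phi> (basis_vec i)) \<in> free_ge b' e"
    by (simp add: ideal_smult_base flip: ideal_smult_poly_ge_free_mod)
qed

lemma module_hom_fscale_diff:
  assumes "module_hom fscale fscale f" "module_hom fscale fscale g"
  shows "module_hom fscale fscale (\<lambda>x. f x - g x)"
  by (rule module_pair.module_hom_sub[OF module_pair.intro[OF module_fscale module_fscale] assms])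

text \<open>Basis vectors from \<open>b\<close> on are sent to 0, which yields a linear map on the
  whole free module of countable rank, as \<open>module_hom\<close> demands.\<close>

definition lin_ext :: "nat \<Rightarrow> (nat \<Rightarrow> (nat \<Rightarrow>\<^sub>0 'r::comm_ring_1)) \<Rightarrow> (nat \<Rightarrow>\<^sub>0 'r) \<Rightarrow> (nat \<Rightarrow>\<^sub>0 'r)" where
  "lin_ext b y x = (\<Sum>i<b. fscale (lookup x i) (y i))"

lemma module_hom_lin_ext: "module_hom fscale fscale (lin_ext b y)"
  by (rule module_hom.intro[OF module_fscale module_fscale], unfold_locales)
    (simp_all add: lin_ext_def lookup_add lookup_fscale fs.scale_left_distrib sum.distrib
      fs.scale_sum_right)

lemma lin_ext_basis_vec: "i < b \<Longrightarrow> lin_ext b y (basis_vec i) = y i"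
  by (simp add: lin_ext_def lookup_single when_def if_distrib[of "\<lambda>a. fscale a _"] cong: if_cong)

text \<open>This is projectivity of free modules: preimages are chosen for the basis vectors only
  and then extended linearly.\<close>

lemma module_hom_lift:
  assumes \<delta>: "module_hom fscale fscale \<delta>" and w: "module_hom fscale fscale w"
    and im: "w ` free_mod a \<subseteq> \<delta> ` free_mod b"
  shows "\<exists>h. module_hom fscale fscale h \<and> h ` free_mod a \<subseteq> free_mod b \<and>
    (\<forall>x\<in>free_mod a. \<delta> (h x) = w x)"
proof -
  have "\<exists>y. i < a \<longrightarrow> y \<in> free_mod b \<and> \<delta> y = w (basis_vec i)" for i
    using im basis_vec_in_free_mod[of i a] by fastforce
  then obtain y where y: "\<And>i. i < a \<Longrightarrow> y i \<in> free_mod b \<and> \<delta> (y i) = w (basis_vec i)" by metis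
  let ?h = "lin_ext a y"
  have "?h x \<in> free_mod b" if "x \<in> free_mod a" for x
    using module_hom_lin_ext _ subspace_free_mod that
    by (rule module_hom_free_mod) (simp add: lin_ext_basis_vec y)
  moreover have "\<delta> (?h x) = w x" if "x \<in> free_mod a" for x
    using module_hom_compose[OF module_hom_lin_ext \<delta>, unfolded o_def] w _ that
    by (rule module_hom_eq_on_free_mod) (simp add: lin_ext_basis_vec y)
  ultimately show ?thesis using module_hom_lin_ext by blast
qed

text \<open>Needed in two places: homogeneous elements of an image lift in the same degree, and the
  image is a graded submodule, to which Artin--Rees applies.\<close>

lemma module_hom_hcomp:
  assumes "module_hom fscale fscale \<phi>" "\<And>k. \<phi> ` free_gr b d k \<subseteq> free_gr b' d' k"
    and "x \<in> free_mod b"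
  shows "hcomp d' k (\<phi> x) = \<phi> (hcomp d k x)"
proof -
  interpret module_hom fscale fscale \<phi> by fact
  obtain K where K: "finite K" "x = (\<Sum>k\<in>K. hcomp d k x)" "\<forall>k. k \<notin> K \<longrightarrow> hcomp d k x = 0"
    by (rule hcomp_decomposition[of x d])
  have *: "\<phi> (hcomp d k' x) \<in> free_gr b' d' k'" for k'
    using assms(2) hcomp_in_free_gr[OF assms(3)] by blast
  have "hcomp d' k (\<phi> x) = hcomp d' k (\<Sum>k'\<in>K. \<phi> (hcomp d k' x))"
    by (subst K(2)) (simp add: sum)
  also have "\<dots> = (\<Sum>k'\<in>K. if k = k' then \<phi> (hcomp d k' x) else 0)"
    unfolding hcomp_sum by (intro sum.cong refl hcomp_homogeneous[OF *])
  also have "\<dots> = \<phi> (hcomp d k x)" using K(1,3) by (simp add: zero)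
  finally show ?thesis .
qed

text \<open>The conditions on \<open>j \<ge> 1\<close> are restated with \<open>Suc j\<close>. The
  last item is derived: the basis vectors are homogeneous, so the graded condition determines where
  they go.\<close>

lemma graded_free_resolutionD:
  assumes "graded_free_resolution scale gr F"
  shows "module_hom fscale scale (aug F)" "\<And>k. aug F ` fgr F 0 k \<subseteq> gr k" "aug F ` fmod F 0 = UNIV"
    "\<And>x. x \<in> fmod F 0 \<Longrightarrow> aug F x = 0 \<longleftrightarrow> x \<in> dif F (Suc 0) ` fmod F (Suc 0)"
    "\<And>j. module_hom fscale fscale (dif F (Suc j))"
    "\<And>j k. dif F (Suc j) ` fgr F (Suc j) k \<subseteq> fgr F j k"
    "\<And>j x. x \<in> fmod F (Suc j) \<Longrightarrow>
      dif F (Suc j) x = 0 \<longleftrightarrow> x \<in> dif F (Suc (Suc j)) ` fmod F (Suc (Suc j))"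
    "\<And>j. dif F (Suc j) ` fmod F (Suc j) \<subseteq> fmod F j"
proof -
  note a = assms[unfolded graded_free_resolution_def]
  show "module_hom fscale scale (aug F)" by (rule a[THEN conjunct1])
  show "aug F ` fgr F 0 k \<subseteq> gr k" for k
    by (rule spec[OF a[THEN conjunct2, THEN conjunct1]])
  show "aug F ` fmod F 0 = UNIV" by (rule a[THEN conjunct2, THEN conjunct2, THEN conjunct1])
  have "{x \<in> fmod F 0. aug F x = 0} = dif F (Suc 0) ` fmod F (Suc 0)"
    using a[THEN conjunct2, THEN conjunct2, THEN conjunct2, THEN conjunct1] by simp
  then show "x \<in> fmod F 0 \<Longrightarrow> aug F x = 0 \<longleftrightarrow> x \<in> dif F (Suc 0) ` fmod F (Suc 0)" for x
    by blast
  have b: "module_hom fscale fscale (dif F (Suc j))"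
    "\<forall>k. dif F (Suc j) ` fgr F (Suc j) k \<subseteq> fgr F (Suc j - 1) k"
    "{x \<in> fmod F (Suc j). dif F (Suc j) x = 0} = dif F (Suc (Suc j)) ` fmod F (Suc (Suc j))" for j
    using a[THEN conjunct2, THEN conjunct2, THEN conjunct2, THEN conjunct2, rule_format, of "Suc j"]
    by (simp_all del: diff_Suc_1)
  show c: "module_hom fscale fscale (dif F (Suc j))" for j by (rule b)
  show d: "dif F (Suc j) ` fgr F (Suc j) k \<subseteq> fgr F j k" for j k using b(2)[of j] by simp
  show "x \<in> fmod F (Suc j) \<Longrightarrow>
      dif F (Suc j) x = 0 \<longleftrightarrow> x \<in> dif F (Suc (Suc j)) ` fmod F (Suc (Suc j))" for j x
    using b(3)[of j] by blast
  have "dif F (Suc j) (basis_vec i) \<in> fmod F j" if "i < rnk F (Suc j)" for i j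
    using d[of j] basis_vec_in_free_gr[OF that] free_gr_sub unfolding fgr_def fmod_def by blast
  then show "dif F (Suc j) ` fmod F (Suc j) \<subseteq> fmod F j" for j
    using module_hom_free_mod[OF c[of j], of "rnk F (Suc j)" "fmod F j"]
    by (auto simp: fmod_def subspace_free_mod)
qed

lemma dif_dif:
  assumes "graded_free_resolution scale gr F" "x \<in> fmod F (Suc (Suc j))"
  shows "dif F (Suc j) (dif F (Suc (Suc j)) x) = 0"
  using graded_free_resolutionD(7,8)[OF assms(1)] assms(2) by blast

lemma aug_dif:
  assumes "graded_free_resolution scale gr F" "x \<in> fmod F (Suc 0)"
  shows "aug F (dif F (Suc 0) x) = 0"
  using graded_free_resolutionD(4,8)[OF assms(1)] assms(2) by blast

text \<open>The grading of the module offers only the uniqueness of finite decompositions. The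
  family \<open>c\<close> is packaged as a finitely supported function and compared with the
  decomposition of \<open>v\<close> having a single component.\<close>

lemma (in graded_module) homogeneous_component_unique:
  assumes K: "finite K" and c: "\<And>k. c k \<in> gr k" "\<And>k. k \<notin> K \<Longrightarrow> c k = 0"
    and v: "v \<in> gr k" "v = (\<Sum>k\<in>K. c k)"
  shows "c k = v"
proof -
  let ?P = "\<lambda>x f. (\<forall>d. lookup f d \<in> gr d) \<and> x = (\<Sum>d\<in>keys f. lookup f d)"
  have "k \<in> K" if "c k \<noteq> 0" for k using c(2)[of k] that by blast
  then have "{k. c k \<noteq> 0} \<subseteq> K" by blast
  then have fin: "finite {k. c k \<noteq> 0}" using K by (rule finite_subset)
  define f where "f = Abs_poly_mapping c"
  have f: "lookup f = c" unfolding f_def using fin by simp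
  have "keys f \<subseteq> K" using c(2) by (force simp: in_keys_iff f)
  then have "(\<Sum>d\<in>keys f. c d) = (\<Sum>d\<in>K. c d)"
    using K by (intro sum.mono_neutral_left) (auto simp: in_keys_iff f)
  then have "?P v f" using c(1) v(2) by (simp add: f)
  moreover have "?P v (single k v)" using v(1) gr_zero by (auto simp: lookup_single when_def)
  moreover have "\<exists>!f. ?P v f" by (rule gr_direct_sum)
  ultimately have "f = single k v" by blast
  then show ?thesis using f by (metis lookup_single_eq)
qed

text \<open>Take any preimage and keep its component of degree \<open>k\<close>; uniqueness of
  decompositions forces this component to map onto \<open>v\<close>.\<close>

lemma lift_homogeneous_aug:
  assumes "graded_module scale gr" and G: "graded_free_resolution scale gr G" and v: "v \<in> gr k"
  shows "\<exists>y\<in>fgr G 0 k. aug G y = v"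
proof -
  interpret graded_module scale gr by fact
  note G = graded_free_resolutionD[OF G]
  interpret aug: module_hom fscale scale "aug G" by (rule G)
  obtain y where y: "y \<in> fmod G 0" "aug G y = v" using G(3) by (metis UNIV_I imageE)
  obtain K where K: "finite K" "y = (\<Sum>k\<in>K. hcomp (shift G 0) k y)"
    "\<forall>k. k \<notin> K \<longrightarrow> hcomp (shift G 0) k y = 0"
    by (rule hcomp_decomposition[of y "shift G 0"])
  have y': "hcomp (shift G 0) k y \<in> fgr G 0 k" for k
    using y(1) by (simp add: fmod_def fgr_def hcomp_in_free_gr)
  have sum: "v = (\<Sum>k\<in>K. aug G (hcomp (shift G 0) k y))"
    using y(2) K(2) by (metis aug.sum)
  have "aug G (hcomp (shift G 0) k y) = v"
  proof (rule homogeneous_component_unique[OF K(1) _ _ v sum])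
    show "aug G (hcomp (shift G 0) k' y) \<in> gr k'" for k' using G(2) y' by blast
    show "k' \<notin> K \<Longrightarrow> aug G (hcomp (shift G 0) k' y) = 0" for k'
      using K(3) by (simp add: aug.zero)
  qed
  then show ?thesis using y' by blast
qed

lemma lift_homogeneous_dif:
  assumes G: "graded_free_resolution scale gr G"
    and v: "v \<in> fgr G j k" "v \<in> dif G (Suc j) ` fmod G (Suc j)"
  shows "\<exists>y\<in>fgr G (Suc j) k. dif G (Suc j) y = v"
proof -
  note G = graded_free_resolutionD[OF G]
  obtain y where y: "y \<in> fmod G (Suc j)" "dif G (Suc j) y = v" using v by blast
  have "dif G (Suc j) (hcomp (shift G (Suc j)) k y) = hcomp (shift G j) k v"
    using module_hom_hcomp[OF G(5)[of j] G(6)[of j, unfolded fgr_def] y(1)[unfolded fmod_def]] y(2)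
    by simp
  also have "\<dots> = v" using hcomp_homogeneous v(1) unfolding fgr_def by metis
  finally show ?thesis using y(1) hcomp_in_free_gr unfolding fmod_def fgr_def by blast
qed

lemma comparison_map:
  fixes F G :: "('n::finite, 'k::field, 'm::ab_group_add) free_complex"
  assumes M: "graded_module scale gr"
    and F: "graded_free_resolution scale gr F" and G: "graded_free_resolution scale gr G"
  obtains f where "\<And>j. module_hom fscale fscale (f j)" "\<And>j k. f j ` fgr F j k \<subseteq> fgr G j k"
    "\<And>j. f j ` fmod F j \<subseteq> fmod G j"
    "\<And>x. x \<in> fmod F 0 \<Longrightarrow> aug G (f 0 x) = aug F x"
    "\<And>j x. x \<in> fmod F (Suc j) \<Longrightarrow> dif G (Suc j) (f (Suc j) x) = f j (dif F (Suc j) x)"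
proof -
  note FD = graded_free_resolutionD[OF F]
  note GD = graded_free_resolutionD[OF G]
  \<comment> \<open>The last clause is the invariant that makes the next lift possible: after the
    differential of \<open>F\<close>, the map lands in the image of the next differential of
    \<open>G\<close>. The link between consecutive maps is recorded in \<open>Q\<close>.\<close>
  define P where "P j \<phi> \<longleftrightarrow> module_hom fscale fscale \<phi> \<and> (\<forall>k. \<phi> ` fgr F j k \<subseteq> fgr G j k) \<and>
      \<phi> ` fmod F j \<subseteq> fmod G j \<and> (j = 0 \<longrightarrow> (\<forall>x\<in>fmod F 0. aug G (\<phi> x) = aug F x)) \<and>
      (\<forall>x\<in>fmod F (Suc j). \<phi> (dif F (Suc j) x) \<in> dif G (Suc j) ` fmod G (Suc j))" for j \<phi>
  define Q where "Q j \<phi> \<psi> \<longleftrightarrow> (\<forall>x\<in>fmod F (Suc j). dif G (Suc j) (\<psi> x) = \<phi> (dif F (Suc j) x))"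
    for j and \<phi> \<psi> :: "(nat \<Rightarrow>\<^sub>0 ('n, 'k) mpoly) \<Rightarrow> (nat \<Rightarrow>\<^sub>0 ('n, 'k) mpoly)"
  have graded: "\<phi> ` fmod F j \<subseteq> fmod G j \<and> (\<forall>k. \<phi> ` fgr F j k \<subseteq> fgr G j k)"
    if "module_hom fscale fscale \<phi>" "\<And>i. i < rnk F j \<Longrightarrow> \<phi> (basis_vec i) \<in> fgr G j (shift F j i)"
    for \<phi> j
  proof -
    have "\<phi> (basis_vec i) \<in> fmod G j" if "i < rnk F j" for i
      using \<open>\<And>i. i < rnk F j \<Longrightarrow> \<phi> (basis_vec i) \<in> fgr G j (shift F j i)\<close>[OF that] free_gr_sub
      unfolding fgr_def fmod_def by blast
    then show ?thesis
      using that module_hom_free_mod[of \<phi> "rnk F j" "fmod G j"] subspace_free_mod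
        module_hom_free_gr[of \<phi> "rnk F j" "rnk G j" "shift G j" "shift F j"]
      unfolding fgr_def fmod_def by blast
  qed
  have "\<exists>f. \<forall>j. P j (f j) \<and> Q j (f j) (f (Suc j))"
  proof (rule dependent_nat_choice)
    have "\<exists>y. i < rnk F 0 \<longrightarrow> y \<in> fgr G 0 (shift F 0 i) \<and> aug G y = aug F (basis_vec i)" for i
    proof (cases "i < rnk F 0")
      case True
      then have "aug F (basis_vec i) \<in> gr (shift F 0 i)"
        using FD(2) basis_vec_in_free_gr[OF True] unfolding fgr_def by blast
      then show ?thesis using lift_homogeneous_aug[OF M G] by blast
    qed simp
    then obtain y where y: "\<And>i. i < rnk F 0 \<Longrightarrow>
        y i \<in> fgr G 0 (shift F 0 i) \<and> aug G (y i) = aug F (basis_vec i)" by metis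
    let ?f = "lin_ext (rnk F 0) y"
    have f: "?f ` fmod F 0 \<subseteq> fmod G 0 \<and> (\<forall>k. ?f ` fgr F 0 k \<subseteq> fgr G 0 k)"
      by (rule graded[OF module_hom_lin_ext]) (simp add: lin_ext_basis_vec y)
    have aug: "aug G (?f x) = aug F x" if "x \<in> fmod F 0" for x
      using module_hom_compose[OF module_hom_lin_ext GD(1), unfolded o_def] FD(1) _ that[unfolded fmod_def]
      by (rule module_hom_eq_on_free_mod) (simp add: lin_ext_basis_vec y)
    have "?f (dif F (Suc 0) x) \<in> dif G (Suc 0) ` fmod G (Suc 0)" if x: "x \<in> fmod F (Suc 0)" for x
    proof -
      have d: "dif F (Suc 0) x \<in> fmod F 0" using FD(8) x by blast
      then have "?f (dif F (Suc 0) x) \<in> fmod G 0" using f by blast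
      moreover have "aug G (?f (dif F (Suc 0) x)) = 0" using aug[OF d] aug_dif[OF F x] by simp
      ultimately show ?thesis using GD(4) by blast
    qed
    then have "P 0 ?f" using module_hom_lin_ext f aug by (simp add: P_def)
    then show "\<exists>f. P 0 f" by blast
  next
    fix \<phi> j assume "P j \<phi>"
    then have \<phi>: "module_hom fscale fscale \<phi>" "\<And>k. \<phi> ` fgr F j k \<subseteq> fgr G j k"
      "\<And>x. x \<in> fmod F (Suc j) \<Longrightarrow> \<phi> (dif F (Suc j) x) \<in> dif G (Suc j) ` fmod G (Suc j)"
      by (auto simp: P_def)
    interpret \<phi>: module_hom fscale fscale \<phi> by (rule \<phi>)
    have "\<exists>y. i < rnk F (Suc j) \<longrightarrow> y \<in> fgr G (Suc j) (shift F (Suc j) i) \<and>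
        dif G (Suc j) y = \<phi> (dif F (Suc j) (basis_vec i))" for i
    proof (cases "i < rnk F (Suc j)")
      case True
      then have "basis_vec i \<in> fmod F (Suc j)" "basis_vec i \<in> fgr F (Suc j) (shift F (Suc j) i)"
        by (simp_all add: fmod_def fgr_def basis_vec_in_free_mod basis_vec_in_free_gr)
      then have "\<phi> (dif F (Suc j) (basis_vec i)) \<in> dif G (Suc j) ` fmod G (Suc j)"
        "\<phi> (dif F (Suc j) (basis_vec i)) \<in> fgr G j (shift F (Suc j) i)"
        using \<phi>(2,3) FD(6) by blast+
      then show ?thesis using lift_homogeneous_dif[OF G] by blast
    qed simp
    then obtain y where y: "\<And>i. i < rnk F (Suc j) \<Longrightarrow> y i \<in> fgr G (Suc j) (shift F (Suc j) i) \<and>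
        dif G (Suc j) (y i) = \<phi> (dif F (Suc j) (basis_vec i))" by metis
    let ?f = "lin_ext (rnk F (Suc j)) y"
    have f: "?f ` fmod F (Suc j) \<subseteq> fmod G (Suc j) \<and> (\<forall>k. ?f ` fgr F (Suc j) k \<subseteq> fgr G (Suc j) k)"
      by (rule graded[OF module_hom_lin_ext]) (simp add: lin_ext_basis_vec y)
    have comm: "dif G (Suc j) (?f x) = \<phi> (dif F (Suc j) x)" if "x \<in> fmod F (Suc j)" for x
      using module_hom_compose[OF module_hom_lin_ext GD(5), unfolded o_def]
        module_hom_compose[OF FD(5) \<phi>(1), unfolded o_def] _ that[unfolded fmod_def]
      by (rule module_hom_eq_on_free_mod) (simp add: lin_ext_basis_vec y)
    have "?f (dif F (Suc (Suc j)) x) \<in> dif G (Suc (Suc j)) ` fmod G (Suc (Suc j))"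
      if x: "x \<in> fmod F (Suc (Suc j))" for x
    proof -
      have d: "dif F (Suc (Suc j)) x \<in> fmod F (Suc j)" using FD(8) x by blast
      then have "?f (dif F (Suc (Suc j)) x) \<in> fmod G (Suc j)" using f by blast
      moreover have "dif G (Suc j) (?f (dif F (Suc (Suc j)) x)) = 0"
        using comm[OF d] dif_dif[OF F x] by (simp add: \<phi>.zero)
      ultimately show ?thesis using GD(7) by blast
    qed
    then have "P (Suc j) ?f \<and> Q j \<phi> ?f" using module_hom_lin_ext f comm by (simp add: P_def Q_def)
    then show "\<exists>\<psi>. P (Suc j) \<psi> \<and> Q j \<phi> \<psi>" by blast
  qed
  then obtain f where "\<And>j. P j (f j)" "\<And>j. Q j (f j) (f (Suc j))" by blast
  then show ?thesis by (intro that[of f]) (auto simp: P_def Q_def)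
qed

text \<open>A chain endomorphism over the zero map is null-homotopic. Only the consequence modulo the
  maximal ideal is kept: on cycles of \<open>F \<otimes> K\<close> it is a boundary.\<close>

lemma null_homotopic_mod:
  fixes u :: "nat \<Rightarrow> (nat \<Rightarrow>\<^sub>0 ('n::finite, 'k::field) mpoly) \<Rightarrow> (nat \<Rightarrow>\<^sub>0 ('n, 'k) mpoly)"
  assumes F: "graded_free_resolution scale gr F"
    and hom: "\<And>j. module_hom fscale fscale (u j)" and u: "\<And>j. u j ` fmod F j \<subseteq> fmod F j"
    and aug: "\<And>x. x \<in> fmod F 0 \<Longrightarrow> aug F (u 0 x) = 0"
    and comm: "\<And>j x. x \<in> fmod F (Suc j) \<Longrightarrow> dif F (Suc j) (u (Suc j) x) = u j (dif F (Suc j) x)"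
    and z: "z \<in> fmod F j" "j = 0 \<or> dif F j z \<in> free_ge (rnk F (j - 1)) 1"
  shows "\<exists>y\<in>fmod F (Suc j). u j z - dif F (Suc j) y \<in> free_ge (rnk F j) 1"
proof -
  note FD = graded_free_resolutionD[OF F]
  have base: "u 0 x \<in> dif F (Suc 0) ` fmod F (Suc 0)" if "x \<in> fmod F 0" for x
    using FD(4) aug u that by blast
  \<comment> \<open>One component of the homotopy at a time is enough. The stored condition says
    that \<open>u - h d\<close> takes values in boundaries, and lifting it along the next
    differential gives the next component.\<close>
  have "\<exists>h. module_hom fscale fscale h \<and> h ` fmod F j \<subseteq> fmod F (Suc j) \<and>
      (\<forall>x\<in>fmod F (Suc j). u (Suc j) x - h (dif F (Suc j) x) \<in> dif F (Suc (Suc j)) ` fmod F (Suc (Suc j)))" for j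
  proof (induction j)
    case 0
    obtain h where h: "module_hom fscale fscale h" "h ` fmod F 0 \<subseteq> fmod F (Suc 0)"
      "\<And>x. x \<in> fmod F 0 \<Longrightarrow> dif F (Suc 0) (h x) = u 0 x"
      using module_hom_lift[OF FD(5) hom, of 0 "rnk F 0" 0 "rnk F (Suc 0)"] base
      unfolding fmod_def by blast
    interpret d: module_hom fscale fscale "dif F (Suc 0)" by (rule FD)
    have "u (Suc 0) x - h (dif F (Suc 0) x) \<in> dif F (Suc (Suc 0)) ` fmod F (Suc (Suc 0))"
      if x: "x \<in> fmod F (Suc 0)" for x
    proof -
      have dx: "dif F (Suc 0) x \<in> fmod F 0" using FD(8) x by blast
      have "u (Suc 0) x - h (dif F (Suc 0) x) \<in> fmod F (Suc 0)"
        using u h(2) x dx fs.subspace_diff[OF subspace_free_mod] unfolding fmod_def by blast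
      moreover have "dif F (Suc 0) (u (Suc 0) x - h (dif F (Suc 0) x)) = 0"
        by (simp add: d.diff comm[OF x] h(3)[OF dx])
      ultimately show ?thesis using FD(7) by blast
    qed
    with h show ?case by blast
  next
    case (Suc j)
    then obtain h where h: "module_hom fscale fscale h" "h ` fmod F j \<subseteq> fmod F (Suc j)"
      "\<And>x. x \<in> fmod F (Suc j) \<Longrightarrow>
        u (Suc j) x - h (dif F (Suc j) x) \<in> dif F (Suc (Suc j)) ` fmod F (Suc (Suc j))" by blast
    interpret h: module_hom fscale fscale h by (rule h)
    have w: "module_hom fscale fscale (\<lambda>x. u (Suc j) x - h (dif F (Suc j) x))"
      by (intro module_hom_fscale_diff hom module_hom_compose[OF FD(5) h(1), unfolded o_def])
    obtain h' where h': "module_hom fscale fscale h'" "h' ` fmod F (Suc j) \<subseteq> fmod F (Suc (Suc j))"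
      "\<And>x. x \<in> fmod F (Suc j) \<Longrightarrow> dif F (Suc (Suc j)) (h' x) = u (Suc j) x - h (dif F (Suc j) x)"
      using module_hom_lift[OF FD(5) w, of "rnk F (Suc j)" "Suc j" "rnk F (Suc (Suc j))"] h(3)
      unfolding fmod_def by blast
    interpret d: module_hom fscale fscale "dif F (Suc (Suc j))" by (rule FD)
    have "u (Suc (Suc j)) x - h' (dif F (Suc (Suc j)) x)
        \<in> dif F (Suc (Suc (Suc j))) ` fmod F (Suc (Suc (Suc j)))"
      if x: "x \<in> fmod F (Suc (Suc j))" for x
    proof -
      have dx: "dif F (Suc (Suc j)) x \<in> fmod F (Suc j)" using FD(8) x by blast
      have "u (Suc (Suc j)) x - h' (dif F (Suc (Suc j)) x) \<in> fmod F (Suc (Suc j))"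
        using u h'(2) x dx fs.subspace_diff[OF subspace_free_mod] unfolding fmod_def by blast
      moreover have "dif F (Suc (Suc j)) (u (Suc (Suc j)) x - h' (dif F (Suc (Suc j)) x)) = 0"
        by (simp add: d.diff comm[OF x] h'(3)[OF dx] dif_dif[OF F x] h.zero)
      ultimately show ?thesis using FD(7) by blast
    qed
    with h' show ?case by blast
  qed
  note homotopy = this
  show ?thesis
  proof (cases j)
    case 0
    with z obtain y where "y \<in> fmod F (Suc 0)" "u 0 z = dif F (Suc 0) y" using base by blast
    then show ?thesis using 0 fs.subspace_0[OF subspace_free_ge] by force
  next
    case (Suc i)
    obtain h where h: "module_hom fscale fscale h" "h ` fmod F i \<subseteq> fmod F (Suc i)"
      "u (Suc i) z - h (dif F (Suc i) z) \<in> dif F (Suc (Suc i)) ` fmod F (Suc (Suc i))"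
      using homotopy[of i] z Suc by blast
    then obtain y where y: "y \<in> fmod F (Suc j)" "u j z - h (dif F j z) = dif F (Suc j) y"
      unfolding Suc by blast
    \<comment> \<open>Here the cycle condition enters: \<open>h\<close> is linear, so the error term
      inherits the membership of \<open>dif F j z\<close> in \<mm>F.\<close>
    have "h (dif F j z) \<in> free_ge (rnk F j) 1"
      using module_hom_free_ge[OF h(1) h(2)[unfolded fmod_def]] z(2) Suc by simp
    moreover have "u j z - dif F (Suc j) y = h (dif F j z)"
      using y(2) by (simp add: algebra_simps)
    ultimately show ?thesis using y(1) by (intro bexI[of _ y]) simp_all
  qed
qed

section \<open>Graded Betti numbers\<close>

text \<open>A basis of \<open>S\<close> together with a vector of \<open>T\<close> outside
  \<open>S\<close> is still independent, hence extends to a strictly larger basis of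
  \<open>T\<close>. The finite spanning set \<open>W\<close> ensures that \<open>dim\<close> is a
  genuine count of basis elements.\<close>

lemma (in vector_space) dim_diff_nonzero_iff:
  assumes W: "finite W" "T \<subseteq> span W" and S: "subspace S" "S \<subseteq> T"
  shows "dim T - dim S \<noteq> 0 \<longleftrightarrow> S \<noteq> T"
proof
  assume "S \<noteq> T"
  then obtain t where t: "t \<in> T" "t \<notin> S" using S by blast
  obtain B where B: "B \<subseteq> S" "independent B" "S \<subseteq> span B" "card B = dim S"
    by (rule basis_exists)
  have "t \<notin> span B" using t(2) span_minimal[OF B(1) S(1)] by blast
  then have "independent (insert t B)" "t \<notin> B"
    using B(2) independent_insertI span_base by blast+
  moreover have "insert t B \<subseteq> T" using t(1) B(1) S(2) by blast
  ultimately obtain C where C: "insert t B \<subseteq> C" "C \<subseteq> T" "independent C" "T \<subseteq> span C"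
    using maximal_independent_subset_extend by metis
  have "finite C" using independent_span_bound[OF W(1) C(3)] C(2) W(2) by blast
  then have "card (insert t B) \<le> card C" "finite B"
    using C(1) by (auto intro: card_mono finite_subset)
  moreover have "card C = dim T" using C by (intro basis_card_eq_dim)
  ultimately show "dim T - dim S \<noteq> 0" using B(4) \<open>t \<notin> B\<close> by simp
qed auto

lemma fgr_finite_dimensional:
  fixes F :: "('n::finite, 'k::field, 'm) free_complex"
  obtains W where "finite W" "fgr F j k \<subseteq> module.span kscale W"
proof -
  interpret ks: vector_space "kscale :: 'k \<Rightarrow> (nat \<Rightarrow>\<^sub>0 ('n, 'k) mpoly) \<Rightarrow> _"
    by (rule vector_space_kscale)
  define S where "S = {(l :: nat, m :: 'n \<Rightarrow>\<^sub>0 nat). l < rnk F j \<and> int (mdeg m) + shift F j l = k}"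
  define W where "W = (\<lambda>(l, m). single l (single m (1 :: 'k))) ` S"
  have "finite S" unfolding S_def by (rule finite_degree_monomials)
  then have "finite W" unfolding W_def by simp
  moreover have "x \<in> ks.span W" if x: "x \<in> fgr F j k" for x
  proof -
    have "single l (lookup x l) \<in> ks.span W" for l
    proof -
      have "single l (lookup x l) = (\<Sum>m\<in>keys (lookup x l). single l (single m (lookup (lookup x l) m)))"
        by (intro poly_mapping_eqI, subst poly_mapping_sum_single[of "lookup x l"])
          (simp add: lookup_sum lookup_single when_def)
      moreover have "single l (single m (lookup (lookup x l) m)) \<in> ks.span W" if "m \<in> keys (lookup x l)" for m
      proof -
        have "lookup (lookup x l) m \<noteq> 0" using that by (simp add: in_keys_iff)
        then have "(l, m) \<in> S" using mons_free_gr[OF x[unfolded fgr_def]] by (auto simp: S_def mons_def)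
        then have "single l (single m 1) \<in> W" by (force simp: W_def)
        moreover have "single l (single m (lookup (lookup x l) m)) =
            kscale (lookup (lookup x l) m) (single l (single m 1))"
          by (simp add: kscale_def fscale_single const_def mult_single)
        ultimately show ?thesis by (simp only: ks.span_scale ks.span_base)
      qed
      ultimately show ?thesis by (simp only: ks.span_sum)
    qed
    then have "(\<Sum>l\<in>keys x. single l (lookup x l)) \<in> ks.span W" by (rule ks.span_sum)
    then show ?thesis by (simp flip: poly_mapping_sum_single)
  qed
  ultimately show ?thesis by (intro that[of W]) auto
qed

section \<open>Cycles and boundaries modulo the maximal ideal\<close>

lemma tor_boundaries_eq:
  "tor_boundaries F j k = {z \<in> fgr F j k. \<exists>y\<in>fmod F (Suc j). z - dif F (Suc j) y \<in> free_ge (rnk F j) 1}"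
  by (simp add: tor_boundaries_def fmod_def ideal_smult_max_ideal_free_mod)

lemma tor_cycles_eq:
  "tor_cycles F j k = {z \<in> fgr F j k. j = 0 \<or> dif F j z \<in> free_ge (rnk F (j - 1)) 1}"
  by (simp add: tor_cycles_def fmod_def ideal_smult_max_ideal_free_mod)

lemma fgr_fmod: "z \<in> fgr F j k \<Longrightarrow> z \<in> fmod F j"
  unfolding fgr_def fmod_def using free_gr_sub by blast

text \<open>Apply the differential to \<open>z - dif F (Suc j) y\<close>: the second term dies, and
  linear maps preserve \<mm>F.\<close>

lemma tor_boundaries_subset_cycles:
  assumes F: "graded_free_resolution scale gr F"
  shows "tor_boundaries F j k \<subseteq> tor_cycles F j k"
proof
  fix z assume "z \<in> tor_boundaries F j k"
  then obtain y where z: "z \<in> fgr F j k" and y: "y \<in> fmod F (Suc j)"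
    and zy: "z - dif F (Suc j) y \<in> free_ge (rnk F j) 1"
    unfolding tor_boundaries_eq by blast
  show "z \<in> tor_cycles F j k"
  proof (cases j)
    case 0
    then show ?thesis using z by (simp add: tor_cycles_eq)
  next
    case (Suc i)
    interpret d: module_hom fscale fscale "dif F (Suc i)" by (rule graded_free_resolutionD(5)[OF F])
    have "dif F (Suc i) (z - dif F (Suc j) y) \<in> free_ge (rnk F i) 1"
      using module_hom_free_ge[OF graded_free_resolutionD(5)[OF F]] graded_free_resolutionD(8)[OF F]
        zy Suc unfolding fmod_def by blast
    moreover have "dif F (Suc i) (dif F (Suc j) y) = 0"
      unfolding Suc using F y[unfolded Suc] by (rule dif_dif)
    ultimately show ?thesis using z Suc by (simp add: tor_cycles_eq d.diff)
  qed
qed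

lemma subspace_tor_boundaries:
  fixes F :: "('n::finite, 'k::field, 'm::ab_group_add) free_complex"
  assumes F: "graded_free_resolution scale gr F"
  shows "module.subspace kscale (tor_boundaries F j k)"
proof -
  interpret ks: vector_space "kscale :: 'k \<Rightarrow> (nat \<Rightarrow>\<^sub>0 ('n, 'k) mpoly) \<Rightarrow> _"
    by (rule vector_space_kscale)
  interpret d: module_hom fscale fscale "dif F (Suc j)" by (rule graded_free_resolutionD(5)[OF F])
  let ?m = "free_ge (rnk F j) 1 :: (nat \<Rightarrow>\<^sub>0 ('n, 'k) mpoly) set"
  note sub = fs.subspace_add[OF subspace_free_ge, of _ "rnk F j" 1] fs.subspace_scale[OF subspace_free_ge, of _ "rnk F j" 1]
  show ?thesis
  proof (rule ks.subspaceI)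
    have "0 \<in> fmod F (Suc j)" "0 - dif F (Suc j) 0 \<in> ?m" "0 \<in> fgr F j k"
      by (simp_all add: fmod_def fgr_def d.zero fs.subspace_0[OF subspace_free_mod]
          fs.subspace_0[OF subspace_free_ge])
    then show "0 \<in> tor_boundaries F j k" unfolding tor_boundaries_eq by blast
  next
    fix x z assume "x \<in> tor_boundaries F j k" "z \<in> tor_boundaries F j k"
    then obtain y y' where gr: "x \<in> fgr F j k" "z \<in> fgr F j k"
      and y: "y \<in> fmod F (Suc j)" "y' \<in> fmod F (Suc j)"
      and m: "x - dif F (Suc j) y \<in> ?m" "z - dif F (Suc j) y' \<in> ?m"
      unfolding tor_boundaries_eq by blast
    have "(x - dif F (Suc j) y) + (z - dif F (Suc j) y') \<in> ?m" using m by (rule sub)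
    then have "x + z - dif F (Suc j) (y + y') \<in> ?m" by (simp add: d.add algebra_simps)
    moreover have "y + y' \<in> fmod F (Suc j)" using y unfolding fmod_def by (rule fs.subspace_add[OF subspace_free_mod])
    moreover have "x + z \<in> fgr F j k" using gr unfolding fgr_def by (rule free_gr_add)
    ultimately show "x + z \<in> tor_boundaries F j k" unfolding tor_boundaries_eq by blast
  next
    fix c z assume "z \<in> tor_boundaries F j k"
    then obtain y where gr: "z \<in> fgr F j k" and y: "y \<in> fmod F (Suc j)"
      and m: "z - dif F (Suc j) y \<in> ?m"
      unfolding tor_boundaries_eq by blast
    have "fscale (const c) (z - dif F (Suc j) y) \<in> ?m" using m by (rule sub)
    then have "kscale c z - dif F (Suc j) (kscale c y) \<in> ?m"
      by (simp add: kscale_def d.scale fs.scale_right_diff_distrib)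
    moreover have "kscale c y \<in> fmod F (Suc j)"
      using y unfolding fmod_def kscale_def by (rule fs.subspace_scale[OF subspace_free_mod])
    moreover have "kscale c z \<in> fgr F j k"
      using free_gr_fscale[OF single_in_poly_gr[of 0 c] gr[unfolded fgr_def]]
      by (simp add: fgr_def kscale_def const_def)
    ultimately show "kscale c z \<in> tor_boundaries F j k" unfolding tor_boundaries_eq by blast
  qed
qed

lemma minimal_dif:
  assumes F: "minimal_graded_free_resolution scale gr F" and "y \<in> fmod F (Suc j)"
  shows "dif F (Suc j) y \<in> free_ge (rnk F j) 1"
proof -
  have "\<forall>j\<ge>1. dif F j ` fmod F j \<subseteq> ideal_smult fscale max_ideal (fmod F (j - 1))"
    using F unfolding minimal_graded_free_resolution_def by (rule conjunct2)
  from this[rule_format, of "Suc j"] have "dif F (Suc j) ` fmod F (Suc j) \<subseteq> free_ge (rnk F j) 1"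
    by (simp add: fmod_def ideal_smult_max_ideal_free_mod)
  then show ?thesis using assms(2) by blast
qed

lemma basis_vec_not_in_free_ge: "basis_vec i \<notin> free_ge b 1"
proof
  assume "basis_vec i \<in> (free_ge b 1 :: (nat \<Rightarrow>\<^sub>0 ('a, 'b) mpoly) set)"
  then have "lookup (basis_vec i :: nat \<Rightarrow>\<^sub>0 ('a, 'b) mpoly) i \<in> poly_ge 1"
    unfolding free_ge_def by blast
  then show False by (simp add: poly_ge_def)
qed

text \<open>Modulo \<mm> the differentials of the minimal resolution vanish, so its Tor is F/\<mm>F,
  with a basis vector in degree \<open>k\<close> for each shift equal to \<open>k\<close>.
  Comparison maps in both directions transfer this to the chosen resolution. Since only
  non-vanishing matters, each direction moves a single class instead of building an
  isomorphism.\<close>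

lemma betti_nonzero_iff:
  fixes F :: "('n::finite, 'k::field, 'm::ab_group_add) free_complex"
  assumes M: "graded_module scale gr" and min: "minimal_graded_free_resolution scale gr F"
  shows "betti scale gr j k \<noteq> 0 \<longleftrightarrow> (\<exists>i<rnk F j. shift F j i = k)"
proof -
  define G :: "('n, 'k, 'm) free_complex" where "G = chosen_resolution scale gr"
  have F: "graded_free_resolution scale gr F"
    using min by (simp add: minimal_graded_free_resolution_def)
  \<comment> \<open>The existence of \<open>F\<close> is what makes the choice behind
    \<open>chosen_resolution\<close> meaningful.\<close>
  then have G: "graded_free_resolution scale gr G"
    unfolding G_def chosen_resolution_def by (rule someI)
  note FD = graded_free_resolutionD[OF F] and GD = graded_free_resolutionD[OF G]
  obtain W where W: "finite W" "fgr G j k \<subseteq> module.span kscale W" by (rule fgr_finite_dimensional)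
  have "tor_cycles G j k \<subseteq> module.span kscale W" using W(2) by (auto simp: tor_cycles_eq)
  then have betti: "betti scale gr j k \<noteq> 0 \<longleftrightarrow> tor_boundaries G j k \<noteq> tor_cycles G j k"
    unfolding betti_def G_def[symmetric]
    by (intro vector_space.dim_diff_nonzero_iff[OF vector_space_kscale W(1)]
        subspace_tor_boundaries[OF G] tor_boundaries_subset_cycles[OF G])
  obtain f where f: "\<And>j. module_hom fscale fscale (f j)" "\<And>j k. f j ` fgr F j k \<subseteq> fgr G j k"
    "\<And>j. f j ` fmod F j \<subseteq> fmod G j"
    "\<And>x. x \<in> fmod F 0 \<Longrightarrow> aug G (f 0 x) = aug F x"
    "\<And>j x. x \<in> fmod F (Suc j) \<Longrightarrow> dif G (Suc j) (f (Suc j) x) = f j (dif F (Suc j) x)"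
    using comparison_map[OF M F G] by blast
  obtain g where g: "\<And>j. module_hom fscale fscale (g j)" "\<And>j k. g j ` fgr G j k \<subseteq> fgr F j k"
    "\<And>j. g j ` fmod G j \<subseteq> fmod F j"
    "\<And>x. x \<in> fmod G 0 \<Longrightarrow> aug F (g 0 x) = aug G x"
    "\<And>j x. x \<in> fmod G (Suc j) \<Longrightarrow> dif F (Suc j) (g (Suc j) x) = g j (dif G (Suc j) x)"
    using comparison_map[OF M G F] by blast
  interpret f: module_hom fscale fscale "f l" for l by (rule f)
  interpret g: module_hom fscale fscale "g l" for l by (rule g)
  interpret dF: module_hom fscale fscale "dif F (Suc l)" for l by (rule FD)
  interpret dG: module_hom fscale fscale "dif G (Suc l)" for l by (rule GD)
  interpret aF: module_hom fscale scale "aug F" by (rule FD)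
  interpret aG: module_hom fscale scale "aug G" by (rule GD)
  have f_ge: "f l x \<in> free_ge (rnk G l) 1" if "x \<in> free_ge (rnk F l) 1" for l x
    using module_hom_free_ge[OF f(1) f(3)[unfolded fmod_def] that] .
  have g_ge: "g l x \<in> free_ge (rnk F l) 1" if "x \<in> free_ge (rnk G l) 1" for l x
    using module_hom_free_ge[OF g(1) g(3)[unfolded fmod_def] that] .
  have diff: "x - y \<in> fmod H l" if "x \<in> fmod H l" "y \<in> fmod H l"
    for x y l and H :: "('n, 'k, 'm) free_complex"
    using that unfolding fmod_def by (rule fs.subspace_diff[OF subspace_free_mod])
  have gf: "\<exists>y\<in>fmod F (Suc j). (g j (f j z) - z) - dif F (Suc j) y \<in> free_ge (rnk F j) 1"
    if z: "z \<in> fmod F j" "j = 0 \<or> dif F j z \<in> free_ge (rnk F (j - 1)) 1" for z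
  proof (rule null_homotopic_mod[OF F _ _ _ _ z])
    show "module_hom fscale fscale (\<lambda>x. g l (f l x) - x)" for l
      by (intro module_hom_fscale_diff module_hom_compose[OF f(1) g(1), unfolded o_def]
          fs.module_hom_ident)
    show "(\<lambda>x. g l (f l x) - x) ` fmod F l \<subseteq> fmod F l" for l
      using f(3) g(3) diff by blast
    show "aug F (g 0 (f 0 x) - x) = 0" if x: "x \<in> fmod F 0" for x
    proof -
      have "f 0 x \<in> fmod G 0" using f(3) x by blast
      then show ?thesis by (simp add: aF.diff g(4) f(4)[OF x])
    qed
    show "dif F (Suc l) (g (Suc l) (f (Suc l) x) - x) = g l (f l (dif F (Suc l) x)) - dif F (Suc l) x"
      if x: "x \<in> fmod F (Suc l)" for l x
    proof -
      have "f (Suc l) x \<in> fmod G (Suc l)" using f(3) x by blast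
      then show ?thesis by (simp add: dF.diff g(5) f(5)[OF x])
    qed
  qed
  have fg: "\<exists>y\<in>fmod G (Suc j). (f j (g j z) - z) - dif G (Suc j) y \<in> free_ge (rnk G j) 1"
    if z: "z \<in> fmod G j" "j = 0 \<or> dif G j z \<in> free_ge (rnk G (j - 1)) 1" for z
  proof (rule null_homotopic_mod[OF G _ _ _ _ z])
    show "module_hom fscale fscale (\<lambda>x. f l (g l x) - x)" for l
      by (intro module_hom_fscale_diff module_hom_compose[OF g(1) f(1), unfolded o_def]
          fs.module_hom_ident)
    show "(\<lambda>x. f l (g l x) - x) ` fmod G l \<subseteq> fmod G l" for l
      using f(3) g(3) diff by blast
    show "aug G (f 0 (g 0 x) - x) = 0" if x: "x \<in> fmod G 0" for x
    proof -
      have "g 0 x \<in> fmod F 0" using g(3) x by blast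
      then show ?thesis by (simp add: aG.diff f(4) g(4)[OF x])
    qed
    show "dif G (Suc l) (f (Suc l) (g (Suc l) x) - x) = f l (g l (dif G (Suc l) x)) - dif G (Suc l) x"
      if x: "x \<in> fmod G (Suc l)" for l x
    proof -
      have "g (Suc l) x \<in> fmod F (Suc l)" using g(3) x by blast
      then show ?thesis by (simp add: dG.diff f(5) g(5)[OF x])
    qed
  qed
  have ge_diff: "x - y \<in> free_ge b 1" if "x \<in> free_ge b 1" "y \<in> free_ge b 1"
    for x y :: "nat \<Rightarrow>\<^sub>0 ('n, 'k) mpoly" and b
    using that by (rule fs.subspace_diff[OF subspace_free_ge])
  have ge_add: "x + y \<in> free_ge b 1" if "x \<in> free_ge b 1" "y \<in> free_ge b 1"
    for x y :: "nat \<Rightarrow>\<^sub>0 ('n, 'k) mpoly" and b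
    using that by (rule fs.subspace_add[OF subspace_free_ge])
  show ?thesis unfolding betti
  proof
    assume "tor_boundaries G j k \<noteq> tor_cycles G j k"
    then obtain z where z: "z \<in> tor_cycles G j k" "z \<notin> tor_boundaries G j k"
      using tor_boundaries_subset_cycles[OF G] by blast
    have zG: "z \<in> fgr G j k" using z(1) by (simp add: tor_cycles_eq)
    show "\<exists>i<rnk F j. shift F j i = k"
    proof (rule ccontr)
      assume no: "\<not> (\<exists>i<rnk F j. shift F j i = k)"
      \<comment> \<open>With no basis vector in degree \<open>k\<close>, every
        degree-\<open>k\<close> element of \<open>F\<close> has coefficients of positive degree, so
        \<open>g j z\<close> lies in \<mm>F. Its image under \<open>f j\<close> vanishes modulo
        \<mm> but is homologous to \<open>z\<close>, which makes \<open>z\<close> a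
        boundary.\<close>
      have gz: "g j z \<in> free_gr (rnk F j) (shift F j) k" using g(2) zG unfolding fgr_def by blast
      have "1 \<le> mdeg m" if "(l, m) \<in> mons (g j z)" for l m
      proof -
        have "l < rnk F j" "int (mdeg m) + shift F j l = k" using mons_free_gr[OF gz] that by auto
        with no have "mdeg m \<noteq> 0" by auto
        then show ?thesis by simp
      qed
      then have "g j z \<in> free_ge (rnk F j) 1" using subsetD[OF free_gr_sub gz] by (auto simp: free_ge_mons)
      then have fgz: "f j (g j z) \<in> free_ge (rnk G j) 1" by (rule f_ge)
      obtain y where y: "y \<in> fmod G (Suc j)" "(f j (g j z) - z) - dif G (Suc j) y \<in> free_ge (rnk G j) 1"
        using fg[OF fgr_fmod[OF zG]] z(1) unfolding tor_cycles_eq by blast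
      have "z - dif G (Suc j) (- y) = f j (g j z) - ((f j (g j z) - z) - dif G (Suc j) y)"
        by (simp add: dG.neg)
      then have "z - dif G (Suc j) (- y) \<in> free_ge (rnk G j) 1"
        using ge_diff[OF fgz y(2)] by (simp only:)
      moreover have "- y \<in> fmod G (Suc j)"
        using y(1) unfolding fmod_def by (rule fs.subspace_neg[OF subspace_free_mod])
      ultimately show False using z(2) zG unfolding tor_boundaries_eq by blast
    qed
  next
    assume "\<exists>i<rnk F j. shift F j i = k"
    then obtain i where i: "i < rnk F j" "shift F j i = k" by blast
    \<comment> \<open>The class to exhibit is that of \<open>f j ?e\<close>. Were it a boundary,
      \<open>g j (f j ?e)\<close> would lie in \<mm>F, as boundaries of \<open>F\<close> do; but it
      differs from \<open>?e\<close> by a boundary modulo \<mm>, so \<open>?e\<close> would lie in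
      \<mm>F too.\<close>
    let ?e = "basis_vec i :: nat \<Rightarrow>\<^sub>0 ('n, 'k) mpoly"
    have e: "?e \<in> fgr F j k" "?e \<in> fmod F j"
      using i basis_vec_in_free_gr basis_vec_in_free_mod by (auto simp: fgr_def fmod_def)
    have de: "j = 0 \<or> dif F j ?e \<in> free_ge (rnk F (j - 1)) 1"
      using minimal_dif[OF min, of ?e "j - 1"] e(2) by (cases j) auto
    have fe: "f j ?e \<in> fgr G j k" using f(2) e(1) by blast
    have "j = 0 \<or> dif G j (f j ?e) \<in> free_ge (rnk G (j - 1)) 1"
    proof (cases j)
      case (Suc l)
      then show ?thesis using f_ge de f(5)[of ?e l] e(2) by simp
    qed simp
    then have "f j ?e \<in> tor_cycles G j k" using fe by (simp add: tor_cycles_eq)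
    moreover have "f j ?e \<notin> tor_boundaries G j k"
    proof
      assume "f j ?e \<in> tor_boundaries G j k"
      then obtain y where y: "y \<in> fmod G (Suc j)" "f j ?e - dif G (Suc j) y \<in> free_ge (rnk G j) 1"
        unfolding tor_boundaries_eq by blast
      have "g j (f j ?e) - g j (dif G (Suc j) y) \<in> free_ge (rnk F j) 1"
        using g_ge[OF y(2)] by (simp add: g.diff)
      moreover have "g j (dif G (Suc j) y) \<in> free_ge (rnk F j) 1"
      proof -
        have "g (Suc j) y \<in> fmod F (Suc j)" using g(3) y(1) by blast
        then show ?thesis using minimal_dif[OF min] g(5)[OF y(1)] by metis
      qed
      ultimately have gfe: "g j (f j ?e) \<in> free_ge (rnk F j) 1" using ge_add by fastforce
      obtain y' where y': "y' \<in> fmod F (Suc j)"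
        "(g j (f j ?e) - ?e) - dif F (Suc j) y' \<in> free_ge (rnk F j) 1"
        using gf[OF e(2) de] by blast
      have "?e = g j (f j ?e) - (((g j (f j ?e) - ?e) - dif F (Suc j) y') + dif F (Suc j) y')"
        by simp
      moreover have "\<dots> \<in> free_ge (rnk F j) 1"
        by (intro ge_diff ge_add gfe y'(2) minimal_dif[OF min y'(1)])
      ultimately have "?e \<in> free_ge (rnk F j) 1" by simp
      then show False using basis_vec_not_in_free_ge by blast
    qed
    ultimately show "tor_boundaries G j k \<noteq> tor_cycles G j k" by blast
  qed
qed

section \<open>The regularity bound\<close>

text \<open>\<open>proj_dim\<close> is defined through projective resolutions, so a truncated free
  resolution has to qualify as one.\<close>

lemma projective_free_mod: "projective_submodule (free_mod b :: (nat \<Rightarrow>\<^sub>0 'r::comm_ring_1) set)"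
  unfolding projective_submodule_def
proof (intro conjI exI)
  let ?Q = "{f :: nat \<Rightarrow>\<^sub>0 'r. \<forall>i<b. lookup f i = 0}"
  show "module.subspace fscale (free_mod b :: (nat \<Rightarrow>\<^sub>0 'r) set)" by (rule subspace_free_mod)
  show "module.subspace fscale ?Q"
    by (rule fs.subspaceI) (auto simp: lookup_add lookup_fscale)
  show "free_mod b \<inter> ?Q = {0}"
  proof (intro equalityI subsetI)
    fix x :: "nat \<Rightarrow>\<^sub>0 'r" assume "x \<in> free_mod b \<inter> ?Q"
    then have "lookup x i = 0" for i by (cases "i < b") (auto simp: free_mod_lookup)
    then show "x \<in> {0}" by (auto intro: poly_mapping_eqI)
  qed (simp add: free_mod_lookup)
  show "{x + y |x y. x \<in> free_mod b \<and> y \<in> ?Q} = UNIV"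
  proof (intro equalityI subset_UNIV subsetI)
    fix x :: "nat \<Rightarrow>\<^sub>0 'r"
    define u where "u = (\<Sum>i<b. single i (lookup x i))"
    have u: "lookup u i = (if i < b then lookup x i else 0)" for i
      by (simp add: u_def lookup_sum lookup_single when_def)
    have "u \<in> free_mod b" "x - u \<in> ?Q" by (auto simp: free_mod_lookup u lookup_minus)
    moreover have "x = u + (x - u)" by simp
    ultimately show "x \<in> {x + y |x y. x \<in> free_mod b \<and> y \<in> ?Q}" by blast
  qed
qed

text \<open>A resolution of length smaller than the projective dimension cannot exist, so the ranks up to
  the projective dimension are nonzero.\<close>

lemma rnk_nonzero:
  assumes F: "graded_free_resolution scale gr F" and nz: "\<exists>x::'m::ab_group_add. x \<noteq> 0"
    and p: "proj_dim (scale :: ('n::finite, 'k::field) mpoly \<Rightarrow> 'm \<Rightarrow> 'm) = enat p" and "j \<le> p"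
  shows "rnk F j \<noteq> 0"
proof
  assume 0: "rnk F j = 0"
  note FD = graded_free_resolutionD[OF F]
  have free0: "free_mod 0 = {0 :: nat \<Rightarrow>\<^sub>0 ('n, 'k) mpoly}"
    by (auto simp: free_mod_def)
  show False
  proof (cases j)
    case j: 0
    interpret module_hom fscale scale "aug F" by (rule FD)
    have "(UNIV :: 'm set) = {0}" using FD(3) 0 by (simp add: fmod_def j free0 zero)
    then show False using nz by blast
  next
    case (Suc l)
    \<comment> \<open>Terms beyond \<open>l\<close> are replaced by zero, whatever \<open>F\<close>
      does there. Exactness at \<open>l\<close> survives because the next term of \<open>F\<close>
      is the one of rank 0.\<close>
    define P where "P i = (if i \<le> l then fmod F i else {0})" for i
    have d: "module_hom fscale fscale (dif F i)" if "1 \<le> i" for i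
      using FD(5)[of "i - 1"] that by simp
    have d0: "dif F i 0 = 0" if "1 \<le> i" for i
    proof -
      interpret module_hom fscale fscale "dif F i" using that by (rule d)
      show ?thesis by (rule zero)
    qed
    have Suc_P: "dif F (Suc i) ` P (Suc i) = dif F (Suc i) ` fmod F (Suc i)" if "i \<le> l" for i
    proof (cases "i = l")
      case True
      then show ?thesis using 0 Suc by (simp add: P_def fmod_def free0)
    qed (use that in \<open>simp add: P_def\<close>)
    have "has_projective_resolution scale l"
      unfolding has_projective_resolution_def
    proof (intro exI[of _ P] exI[of _ "dif F"] exI[of _ "aug F"] conjI allI impI)
      fix i
      show "projective_submodule (P i)"
        using projective_free_mod[of "rnk F i", where 'r = "('n, 'k) mpoly"]
          projective_free_mod[of 0, where 'r = "('n, 'k) mpoly"]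
        by (simp add: P_def fmod_def free0)
      show "P i = {0}" if "l < i" using that by (simp add: P_def)
      show "module_hom fscale fscale (dif F i)" if "1 \<le> i" using that by (rule d)
      show "dif F i ` P i \<subseteq> P (i - 1)" if "1 \<le> i"
      proof (cases "i \<le> l")
        case True
        then have "i - 1 \<le> l" by simp
        then show ?thesis using True that FD(8)[of "i - 1"] by (simp add: P_def)
      next
        case False
        have "0 \<in> fmod F (i - 1)"
          unfolding fmod_def by (rule fs.subspace_0[OF subspace_free_mod])
        with False show ?thesis using d0[OF that] by (simp add: P_def)
      qed
      show "{x \<in> P i. dif F i x = 0} = dif F (Suc i) ` P (Suc i)" if "1 \<le> i"
      proof (cases "i \<le> l")
        case True
        obtain i' where "i = Suc i'" using \<open>1 \<le> i\<close> by (cases i) auto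
        then have "{x \<in> fmod F i. dif F i x = 0} = dif F (Suc i) ` fmod F (Suc i)"
          using FD(7)[of _ i'] FD(8)[of i] by blast
        then show ?thesis using True Suc_P[OF True] by (simp add: P_def)
      next
        case False
        then show ?thesis using d0[OF that] d0[of "Suc i"] by (auto simp: P_def)
      qed
    next
      show "module_hom fscale scale (aug F)" by (rule FD)
      show "aug F ` P 0 = UNIV" using FD(3) by (simp add: P_def)
      have "{x \<in> fmod F 0. aug F x = 0} = dif F (Suc 0) ` fmod F (Suc 0)"
        using FD(4) FD(8)[of 0] by blast
      then show "{x \<in> P 0. aug F x = 0} = dif F 1 ` P 1" using Suc_P[of 0] by (simp add: P_def)
    qed
    then have "proj_dim scale \<le> enat l" unfolding proj_dim_def by (intro Inf_lower) blast
    then show False using p \<open>j \<le> p\<close> Suc by simp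
  qed
qed

text \<open>Otherwise the image of the basis vector would lie in \<open>\<mm>\<^bsup>r+1\<^esup>F \<inter> N \<subseteq> \<mm>N\<close>, where \<open>r\<close> is the
  Artin--Rees number of \<open>N\<close>, which contradicts minimality.\<close>

lemma shift_bound:
  fixes F :: "('n::finite, 'k::field, 'm::ab_group_add) free_complex"
  assumes min: "minimal_graded_free_resolution scale gr F" and i: "i < rnk F (Suc j)"
  shows "\<exists>l<rnk F j. shift F (Suc j) i \<le> rho scale gr F (Suc j) + shift F j l"
proof -
  have F: "graded_free_resolution scale gr F"
    using min by (simp add: minimal_graded_free_resolution_def)
  note FD = graded_free_resolutionD[OF F]
  interpret d: module_hom fscale fscale "dif F (Suc j)" by (rule FD)
  define N where "N = dif F (Suc j) ` fmod F (Suc j)"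
  define r where "r = artin_rees N (free_mod (rnk F j))"
  let ?e = "basis_vec i :: nat \<Rightarrow>\<^sub>0 ('n, 'k) mpoly"
  let ?z = "dif F (Suc j) ?e"
  have e: "?e \<in> fmod F (Suc j)" "?e \<in> fgr F (Suc j) (shift F (Suc j) i)"
    using i basis_vec_in_free_gr basis_vec_in_free_mod by (auto simp: fgr_def fmod_def)
  have z: "?z \<in> fgr F j (shift F (Suc j) i)" using e(2) FD(6) by blast
  have "?z \<notin> free_ge (rnk F j) (Suc r)"
  proof
    assume "?z \<in> free_ge (rnk F j) (Suc r)"
    then have z_in: "?z \<in> N \<inter> free_ge (rnk F j) (Suc r)" using e(1) by (simp add: N_def)
    have "module.subspace fscale N"
      unfolding N_def fmod_def by (rule d.subspace_image[OF subspace_free_mod])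
    moreover have "N \<subseteq> free_mod (rnk F j)" using FD(8) by (simp add: N_def fmod_def)
    moreover have "hcomp (shift F j) k x \<in> N" if "x \<in> N" for x k
    proof -
      obtain y where y: "y \<in> fmod F (Suc j)" "x = dif F (Suc j) y" using \<open>x \<in> N\<close> N_def by blast
      have "hcomp (shift F j) k x = dif F (Suc j) (hcomp (shift F (Suc j)) k y)"
        using module_hom_hcomp[OF FD(5) FD(6)[unfolded fgr_def] y(1)[unfolded fmod_def]] y(2) by blast
      moreover have "hcomp (shift F (Suc j)) k y \<in> fmod F (Suc j)"
        using hcomp_in_free_gr y(1) free_gr_sub unfolding fmod_def by blast
      ultimately show ?thesis unfolding N_def by blast
    qed
    ultimately have "N \<inter> free_ge (rnk F j) (Suc r) =
        ideal_smult fscale (poly_ge (Suc r - r)) (N \<inter> free_ge (rnk F j) r)"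
      unfolding r_def
      by (rule artin_rees_spec) (assumption | rule le_SucI[OF order_refl])+
    \<comment> \<open>As \<open>Suc r - r = 1\<close>, the right-hand side lies in \<mm>N, and
      \<mm>N is the image of \<mm> times the source of the differential.\<close>
    also have "\<dots> \<subseteq> dif F (Suc j) ` free_ge (rnk F (Suc j)) 1"
    proof (rule ideal_smult_minimal)
      show "module.subspace fscale (dif F (Suc j) ` free_ge (rnk F (Suc j)) 1)"
        by (rule d.subspace_image[OF subspace_free_ge])
      fix a :: "('n, 'k) mpoly" and x
      assume a: "a \<in> poly_ge (Suc r - r)" and x: "x \<in> N \<inter> free_ge (rnk F j) r"
      then obtain y where y: "y \<in> fmod F (Suc j)" "x = dif F (Suc j) y" unfolding N_def by blast
      have "fscale a y \<in> free_ge (rnk F (Suc j)) 1"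
        using a y(1) by (simp add: fmod_def ideal_smult_base flip: ideal_smult_poly_ge_free_mod)
      then show "fscale a x \<in> dif F (Suc j) ` free_ge (rnk F (Suc j)) 1"
        unfolding y(2) d.scale[symmetric] by blast
    qed
    finally obtain y where y: "y \<in> free_ge (rnk F (Suc j)) 1" "?z = dif F (Suc j) y"
      using z_in by blast
    have "y \<in> fmod F (Suc j)" using y(1) by (simp add: free_ge_def fmod_def)
    then have "?e - y \<in> fmod F (Suc j)"
      using e(1) unfolding fmod_def by (intro fs.subspace_diff[OF subspace_free_mod])
    moreover have "dif F (Suc j) (?e - y) = 0" using y(2) by (simp add: d.diff)
    ultimately obtain w where "w \<in> fmod F (Suc (Suc j))" "?e - y = dif F (Suc (Suc j)) w"
      using FD(7) by blast
    \<comment> \<open>By minimality boundaries lie in \<mm>F; since \<open>y\<close> does too, so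
      would the basis vector.\<close>
    then have "?e - y \<in> free_ge (rnk F (Suc j)) 1" using minimal_dif[OF min] by metis
    then have "(?e - y) + y \<in> free_ge (rnk F (Suc j)) 1"
      using y(1) by (rule fs.subspace_add[OF subspace_free_ge])
    then show False by (simp add: basis_vec_not_in_free_ge del: One_nat_def)
  qed
  moreover have "?z \<in> free_mod (rnk F j)" using z free_gr_sub unfolding fgr_def by blast
  ultimately obtain l m where lm: "(l, m) \<in> mons ?z" "mdeg m \<le> r"
    by (auto simp: free_ge_mons not_less_eq_eq)
  then have "l < rnk F j" "int (mdeg m) + shift F j l = shift F (Suc j) i"
    using mons_free_gr[OF z[unfolded fgr_def]] by auto
  moreover have "rho scale gr F (Suc j) = int r" by (simp add: rho_def r_def N_def fmod_def)
  ultimately show ?thesis using lm(2) by (intro exI[of _ l]) auto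
qed

theorem theorem3p4:
  fixes scale :: "('n::finite, 'k::field) mpoly \<Rightarrow> 'm::ab_group_add \<Rightarrow> 'm"
    and gr :: "int \<Rightarrow> 'm set"
    and F :: "('n, 'k, 'm) free_complex"
    and p :: nat
  assumes "graded_module scale gr"
    and "finitely_generated scale"
    and "\<exists>x::'m. x \<noteq> 0"
    and "proj_dim scale = enat p"
    and "minimal_graded_free_resolution scale gr F"
  shows "(\<forall>j\<le>p. reg_at scale gr j \<le> (\<Sum>k=0..j. rho scale gr F k) - int j) \<and>
         reg scale gr \<le> Max {(\<Sum>k=0..j. rho scale gr F k) - int j | j. j \<le> p}"
proof -
  note M = assms(1) and min = assms(5)
  have F: "graded_free_resolution scale gr F"
    using min by (simp add: minimal_graded_free_resolution_def)
  have rnk: "rnk F j \<noteq> 0" if "j \<le> p" for j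
    using rnk_nonzero[OF F assms(3,4) that] .
  define S where "S j = (\<lambda>i. shift F j i - int j) ` {..<rnk F j}" for j
  have S: "finite (S j)" for j by (simp add: S_def)
  have "{k - int j |k. betti scale gr j k \<noteq> 0} = S j" for j
    unfolding betti_nonzero_iff[OF M min] S_def by auto
  then have reg: "reg_at scale gr j = Max (S j)" for j by (simp add: reg_at_def)
  have bound: "j \<le> p \<Longrightarrow> reg_at scale gr j \<le> (\<Sum>k=0..j. rho scale gr F k) - int j" for j
  proof (induction j)
    case 0
    then show ?case by (simp add: rho_def)
  next
    case (Suc j)
    \<comment> \<open>The rank is nonzero up to the projective dimension, so this Max is attained by
      an actual shift.\<close>
    have "S (Suc j) \<noteq> {}" using rnk[OF Suc.prems] by (auto simp: S_def)
    then have "Max (S (Suc j)) \<in> S (Suc j)" by (intro Max_in S)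
    then obtain i where i: "i < rnk F (Suc j)" "Max (S (Suc j)) = shift F (Suc j) i - int (Suc j)"
      by (auto simp: S_def)
    obtain l where l: "l < rnk F j" "shift F (Suc j) i \<le> rho scale gr F (Suc j) + shift F j l"
      using shift_bound[OF min i(1)] by blast
    have "shift F j l - int j \<le> Max (S j)" using l(1) by (intro Max_ge S) (auto simp: S_def)
    \<comment> \<open>Adding \<open>int j\<close> to both sides of the induction hypothesis leaves a
      bound on the shifts themselves, to which the next \<open>rho\<close> is added;
      \<open>- int (Suc j)\<close> returns with the regularity.\<close>
    then have "shift F j l \<le> (\<Sum>k=0..j. rho scale gr F k)" using Suc by (simp add: reg)
    then show ?case using i(2) l(2) by (simp add: reg)
  qed
  define A where "A = {(\<Sum>k=0..j. rho scale gr F k) - int j |j. j \<le> p}"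
  have A: "finite A" by (simp add: A_def)
  have R: "{reg_at scale gr j |j. enat j \<le> proj_dim scale} = reg_at scale gr ` {..p}"
    using assms(4) by auto
  have "reg_at scale gr j \<le> Max A" if "j \<le> p" for j
  proof -
    have "(\<Sum>k=0..j. rho scale gr F k) - int j \<in> A" using that unfolding A_def by blast
    from bound[OF that] Max_ge[OF A this] show ?thesis by (rule order_trans)
  qed
  then have "reg scale gr \<le> Max A" unfolding reg_def R by (intro Max.boundedI) auto
  then show ?thesis using bound unfolding A_def by blast
qed

end
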